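(* If $0\le\tilde\xi<\xi$, then $$\frac{\lambda(\xi)-\lambda(\tilde\xi)}{\xi-\tilde\xi}\le\sqrt{2+2\lambda(\xi)+\xi^2}-\xi.$$ In particular, for Lebesgue-a.e. $\xi\ge0$, the derivative $\lambda'(\xi)$ exists and satisfies $$\lambda'(\xi)\le\sqrt{2+2\lambda(\xi)+\xi^2}-\xi.$$
   Context: Let $h$ be a whole-plane Gaussian free field, normalized so that its circle average over the unit circle $\partial\mathbb D$ is zero. For $\varepsilon>0$ and $z\in\mathbb C$, $h_\varepsilon(z)$ denotes the average of $h$ over the circle of radius $\varepsilon$ centered at $z$. Let $\mathbb S=[0,1]^2$ and $\mathbb S^\varepsilon=(\varepsilon\mathbb Z^2)\cap\mathbb S$, with its nearest-neighbor graph structure. For $\xi\ge0$, $\varepsilon>0$ and a lattice path $P:\{0,1,\dots,N\}\to\mathbb S^\varepsilon$ (consecutive vertices are nearest neighbors), define the $\varepsilon$-LFPP (Liouville first passage percolation) length $L_h^{\xi,\varepsilon}(P)=\sum_{j=0}^N\varepsilon e^{\xi h_\varepsilon(P(j))}$. For $z,w\in\mathbb S^\varepsilon$ let $D_h^{\xi,\varepsilon}(z,w)=\inf_P L_h^{\xi,\varepsilon}(P)$, the infimum being over all lattice paths in $\mathbb S^\varepsilon$ from $z$ to $w$; the distance between two sets is the infimum of the distances between their points. Let $\partial_{\mathrm L}\mathbb S^\varepsilon$ (resp. $\partial_{\mathrm R}\mathbb S^\varepsilon$) be the set of vertices of $\mathbb S^\varepsilon$ whose nearest neighbor to the left (resp.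 right) in $\varepsilon\mathbb Z^2$ is not in $\mathbb S^\varepsilon$. For $\xi\ge0$ define the $\xi$-LFPP distance exponent $$\lambda(\xi)=\sup\left\{\alpha\in\mathbb R:\liminf_{\varepsilon\to0}\mathbb P\left[D_h^{\xi,\varepsilon}(\partial_{\mathrm L}\mathbb S^\varepsilon,\partial_{\mathrm R}\mathbb S^\varepsilon)\le\varepsilon^\alpha\right]=1\right\}.$$ *)

theory Defs
  imports "HOL-Probability.Probability"
begin

section \<open>The whole-plane Gaussian free field\<close>

text \<open>
  The field is treated as a Gaussian process indexed by measures rather than as a random
  generalized function, so that it can be evaluated directly on uniform measures on circles:
  the index set consists of the finite, compactly supported Borel measures of finite logarithmic
  energy. Since \<^term>\<open>ln 0 = 0\<close> in HOL, the value \<open>\<infinity>\<close> of the kernel on the diagonal is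
  put in by hand in the finiteness condition; it forces the diagonal to be a null set, which in
  particular excludes measures with atoms.
\<close>

definition finite_log_energy :: "complex measure \<Rightarrow> bool" where
  "finite_log_energy \<mu> \<longleftrightarrow>
     (\<integral>\<^sup>+ (x, y). (if x = y then \<infinity> else ennreal (- ln (dist x y))) \<partial>(\<mu> \<Otimes>\<^sub>M \<mu>)) < \<infinity>"

definition field_index :: "complex measure set" where
  "field_index = {\<mu>. sets \<mu> = sets borel \<and> finite_measure \<mu> \<and>
     (\<exists>R. emeasure \<mu> (- cball 0 R) = 0) \<and> finite_log_energy \<mu>}"

definition log_energy :: "complex measure \<Rightarrow> complex measure \<Rightarrow> real" where
  "log_energy \<mu> \<nu> = (\<integral> (x, y). - ln (dist x y) \<partial>(\<mu> \<Otimes>\<^sub>M \<nu>))"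

definition centered_gaussian :: "'w measure \<Rightarrow> ('w \<Rightarrow> real) \<Rightarrow> real \<Rightarrow> bool" where
  "centered_gaussian M X v \<longleftrightarrow> X \<in> borel_measurable M \<and>
     ((v = 0 \<and> (AE \<omega> in M. X \<omega> = 0)) \<or>
      (v > 0 \<and> distributed M lborel X (normal_density 0 (sqrt v))))"

text \<open>
  The whole-plane field is canonically defined only modulo a (random) additive constant, that is,
  through its values on signed measures of total mass zero. On these it is the centered Gaussian
  process with covariance kernel \<open>- log |x - y|\<close>. The signed measures are the formal linear
  combinations \<open>\<Sum>\<mu>\<in>I. a \<mu> \<cdot> \<mu>\<close>. Because this family is closed under linear
  combinations, prescribing the one-dimensional laws gives joint Gaussianity, the covariances, and
  almost sure linearity of \<^term>\<open>h\<close> in the measure.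
\<close>

definition whole_plane_GFF :: "'w measure \<Rightarrow> (complex measure \<Rightarrow> 'w \<Rightarrow> real) \<Rightarrow> bool" where
  "whole_plane_GFF M h \<longleftrightarrow>
     (\<forall>\<mu>\<in>field_index. h \<mu> \<in> borel_measurable M) \<and>
     (\<forall>I a. finite I \<and> I \<subseteq> field_index \<and> (\<Sum>\<mu>\<in>I. a \<mu> * measure \<mu> (space \<mu>)) = 0 \<longrightarrow>
        centered_gaussian M (\<lambda>\<omega>. \<Sum>\<mu>\<in>I. a \<mu> * h \<mu> \<omega>)
          (\<Sum>\<mu>\<in>I. \<Sum>\<nu>\<in>I. a \<mu> * a \<nu> * log_energy \<mu> \<nu>))"

definition circle_measure :: "complex \<Rightarrow> real \<Rightarrow> complex measure" where
  "circle_measure z r =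
     distr (uniform_measure lborel {0..2 * pi}) borel (\<lambda>t. z + of_real r * cis t)"

definition circle_avg ::
    "(complex measure \<Rightarrow> 'w \<Rightarrow> real) \<Rightarrow> real \<Rightarrow> complex \<Rightarrow> 'w \<Rightarrow> real" where
  "circle_avg h \<epsilon> z = h (circle_measure z \<epsilon>)"

definition normalized_whole_plane_GFF ::
    "'w measure \<Rightarrow> (complex measure \<Rightarrow> 'w \<Rightarrow> real) \<Rightarrow> bool" where
  "normalized_whole_plane_GFF M h \<longleftrightarrow>
     whole_plane_GFF M h \<and> (AE \<omega> in M. circle_avg h 1 0 \<omega> = 0)"

section \<open>Lattice Liouville first passage percolation\<close>

definition lattice_square :: "real \<Rightarrow> complex set" where
  "lattice_square \<epsilon> =
     {z. (\<exists>m n :: int. z = Complex (\<epsilon> * of_int m) (\<epsilon> * of_int n)) \<and>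
         0 \<le> Re z \<and> Re z \<le> 1 \<and> 0 \<le> Im z \<and> Im z \<le> 1}"

definition left_boundary :: "real \<Rightarrow> complex set" where
  "left_boundary \<epsilon> = {z \<in> lattice_square \<epsilon>. z - of_real \<epsilon> \<notin> lattice_square \<epsilon>}"

definition right_boundary :: "real \<Rightarrow> complex set" where
  "right_boundary \<epsilon> = {z \<in> lattice_square \<epsilon>. z + of_real \<epsilon> \<notin> lattice_square \<epsilon>}"

text \<open>A path with \<open>N\<close> steps is given by the values of \<open>P\<close> on \<open>{0..N}\<close>; points of
  \<open>\<epsilon>\<int>\<^sup>2\<close> are nearest neighbours iff their distance is \<open>\<epsilon>\<close>.\<close>

definition lattice_path :: "real \<Rightarrow> nat \<Rightarrow> (nat \<Rightarrow> complex) \<Rightarrow> bool" where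
  "lattice_path \<epsilon> N P \<longleftrightarrow>
     (\<forall>j\<le>N. P j \<in> lattice_square \<epsilon>) \<and> (\<forall>j<N. dist (P j) (P (Suc j)) = \<epsilon>)"

text \<open>In the next three definitions \<^term>\<open>f\<close> is a realization of the field, as a function of the
  lattice point.\<close>

definition lfpp_length :: "(complex \<Rightarrow> real) \<Rightarrow> real \<Rightarrow> real \<Rightarrow> nat \<Rightarrow> (nat \<Rightarrow> complex) \<Rightarrow> real" where
  "lfpp_length f \<xi> \<epsilon> N P = (\<Sum>j = 0..N. \<epsilon> * exp (\<xi> * f (P j)))"

definition lfpp_dist :: "(complex \<Rightarrow> real) \<Rightarrow> real \<Rightarrow> real \<Rightarrow> complex \<Rightarrow> complex \<Rightarrow> real" where
  "lfpp_dist f \<xi> \<epsilon> z w =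
     Inf {lfpp_length f \<xi> \<epsilon> N P | N P. lattice_path \<epsilon> N P \<and> P 0 = z \<and> P N = w}"

definition lfpp_set_dist ::
    "(complex \<Rightarrow> real) \<Rightarrow> real \<Rightarrow> real \<Rightarrow> complex set \<Rightarrow> complex set \<Rightarrow> real" where
  "lfpp_set_dist f \<xi> \<epsilon> A B = Inf {lfpp_dist f \<xi> \<epsilon> z w | z w. z \<in> A \<and> w \<in> B}"

text \<open>\<^const>\<open>Liminf\<close> needs a complete lattice, hence the extended reals. The real supremum is the
  intended one: the set of exponents is nonempty and bounded above whenever \<open>\<xi> \<ge> 0\<close> and
  \<open>h\<close> is a normalized whole-plane field.\<close>

definition lfpp_exponent ::
    "'w measure \<Rightarrow> (complex measure \<Rightarrow> 'w \<Rightarrow> real) \<Rightarrow> real \<Rightarrow> real" where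
  "lfpp_exponent M h \<xi> =
     Sup {\<alpha> :: real.
       Liminf (at_right 0) (\<lambda>\<epsilon> :: real. ereal
         (\<P>(\<omega> in M. lfpp_set_dist (\<lambda>z. circle_avg h \<epsilon> z \<omega>) \<xi> \<epsilon>
                        (left_boundary \<epsilon>) (right_boundary \<epsilon>) \<le> \<epsilon> powr \<alpha>))) = 1}"

end

theory Submission
  imports Defs
begin

text \<open>
  Write \<open>\<kappa>(\<xi>) = sqrt (2 + 2 \<lambda>(\<xi>) + \<xi>\<^sup>2) - \<xi>\<close>. The first inequality says that lowering the parameter
  from \<open>\<xi>\<close> to \<open>\<xi>'\<close> lowers the exponent by at most \<open>(\<xi> - \<xi>') \<kappa>(\<xi>)\<close>. Take a left-right crossing of
  \<open>\<xi>\<close>-length about \<open>\<epsilon>\<^bsup>\<lambda>(\<xi>)\<^esup>\<close> and measure it with the parameter \<open>\<xi>'\<close>. At the vertices with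
  \<open>h\<^sub>\<epsilon> \<ge> - \<theta> log (1/\<epsilon>)\<close> the change of parameter costs a factor at most \<open>\<epsilon>\<^bsup>- (\<xi> - \<xi>') \<theta>\<^esup>\<close>. The
  vertices where the field is lower are rare in the whole square: since \<open>h\<^sub>\<epsilon>(z)\<close> is centered
  Gaussian of variance at most \<open>log (1/\<epsilon>) + O(1)\<close>, there are at most about \<open>\<epsilon>\<^bsup>- (2 - \<theta>\<^sup>2/2)\<^esup>\<close> of
  them near the level \<open>- \<theta> log (1/\<epsilon>)\<close>, and they contribute at most \<open>\<epsilon>\<^bsup>\<theta>\<^sup>2/2 + \<xi>' \<theta> - 1\<^esup>\<close>. The value
  \<open>\<theta> = \<kappa>(\<xi>)\<close> balances the two contributions. The rigorous form of the count is a first moment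
  bound for \<open>\<Sum>\<^sub>z exp (- \<theta> h\<^sub>\<epsilon>(z))\<close>, and the outcome for general parameters is \<open>lam_compare\<close>.

  The threshold argument requires \<open>\<xi>' + \<theta> \<ge> 0\<close>, that is, the exponential tilt which detects low
  values of the field must point in the right direction. When \<open>\<xi>' + \<kappa>(\<xi>) < 0\<close>, crossings along a
  single row of the lattice are already short enough. Their length is again controlled by a first
  moment (\<open>row_exponent\<close>), which gives \<open>\<lambda>(\<xi>) \<ge> - \<xi>\<^sup>2/2\<close> always and \<open>\<lambda>(\<xi>) \<ge> 1 - sqrt 2 \<xi>\<close> for
  \<open>\<xi> \<ge> sqrt 2\<close>; together these two bounds give the claim (\<open>lam_increment_le\<close>).

  For the second part, the same comparison with the roles of the parameters exchanged bounds the
  increments of \<open>\<lambda>\<close> from below, so \<open>\<lambda>\<close> is locally Lipschitz. By Lebesgue's theorem it is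
  differentiable almost everywhere, and the difference quotients from the left are at most
  \<open>\<kappa>(\<xi>)\<close>. Lebesgue's theorem is derived from the Vitali covering theorem.\<close>

section \<open>Almost everywhere differentiability of Lipschitz functions\<close>

text \<open>
  A Vitali covering of \<open>E\<close> by intervals of slope at most \<open>u\<close> inside an open set slightly larger than
  \<open>E\<close> is mapped by \<open>F\<close> to a covering of \<open>F ` E\<close> by intervals that are at most \<open>u\<close> times as long; the
  null set missed by the covering has a null image because \<open>F\<close> is Lipschitz. The inverse function
  enters as a parameter so that the lemma can also be applied with \<open>F\<close> and \<open>G\<close> exchanged.\<close>

lemma emeasure_image_le_of_small_slopes:
  fixes F G :: "real \<Rightarrow> real"
  assumes GF: "\<And>x. G (F x) = x" and FG: "\<And>y. F (G y) = y"
    and mono: "strict_mono F" and lip: "\<And>x y. \<bar>F x - F y\<bar> \<le> L * \<bar>x - y\<bar>"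
    and cont: "continuous_on UNIV G"
    and E: "E \<in> sets borel" and u: "0 \<le> u"
    and cover: "\<And>x d. x \<in> E \<Longrightarrow> 0 < d \<Longrightarrow>
        \<exists>a b. a < b \<and> a \<le> x \<and> x \<le> b \<and> b - a < d \<and> F b - F a \<le> u * (b - a)"
  shows "F ` E \<in> sets borel" "emeasure lborel (F ` E) \<le> ennreal u * emeasure lborel E"
proof -
  have img: "F ` A = G -` A" for A by (auto simp: image_iff) (metis GF FG)+
  have [measurable]: "G \<in> borel_measurable borel"
    using cont by (rule borel_measurable_continuous_onI)
  show FE: "F ` E \<in> sets borel" unfolding img using measurable_sets_borel[OF _ E, of G] by simp
  have Fi: "F ` {a..b} = {F a..F b}" for a b
  proof -
    have "a \<le> G y \<longleftrightarrow> F a \<le> y" "G y \<le> b \<longleftrightarrow> y \<le> F b" for y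
      using strict_mono_less_eq[OF mono, of a "G y"] strict_mono_less_eq[OF mono, of "G y" b] FG by auto
    then show ?thesis unfolding img by auto
  qed
  have approx: "emeasure lborel (F ` E) \<le> ennreal u * emeasure lborel E + ennreal (u * e)"
    if e: "e > 0" for e
  proof -
    obtain T where T: "open T" "E \<subseteq> T" and Te: "emeasure lebesgue (T - E) < ennreal e"
      using sets_lebesgue_outer_open[of E e] E e by (metis sets_completionI_sets sets_lborel)
    define K where "K = {(a, b). a < b \<and> {a..b} \<subseteq> T \<and> F b - F a \<le> u * (b - a)}"
    let ?c = "\<lambda>(a, b). (a + b) / 2 :: real" and ?r = "\<lambda>(a, b). (b - a) / 2 :: real"
    have ball: "cball (?c i) (?r i) = {fst i..snd i}" for i
      by (auto simp: dist_real_def abs_if field_simps split: prod.splits if_splits)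
    have "\<exists>i. i \<in> K \<and> x \<in> cball (?c i) (?r i) \<and> ?r i < d" if x: "x \<in> E" and d: "d > 0" for x d
    proof -
      obtain \<delta> where \<delta>: "\<delta> > 0" "ball x \<delta> \<subseteq> T" using T x by (meson openE subsetD)
      obtain a b where ab: "a < b" "a \<le> x" "x \<le> b" "b - a < min d \<delta>" "F b - F a \<le> u * (b - a)"
        using cover[OF x, of "min d \<delta>"] d \<delta> by auto
      have "{a..b} \<subseteq> ball x \<delta>" using ab by (auto simp: dist_real_def)
      then have "(a, b) \<in> K" using ab \<delta> by (auto simp: K_def)
      moreover have "?r (a, b) < d" using ab by auto
      ultimately show ?thesis using ab ball[of "(a, b)"] by (intro exI[of _ "(a, b)"]) auto
    qed
    moreover have "\<And>i. i \<in> K \<Longrightarrow> 0 < ?r i" by (auto simp: K_def)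
    ultimately obtain C where C: "countable C" "C \<subseteq> K"
        "pairwise (\<lambda>i j. disjnt (cball (?c i) (?r i)) (cball (?c j) (?r j))) C"
        "negligible (E - (\<Union>i\<in>C. cball (?c i) (?r i)))"
      using Vitali_covering_theorem_cballs[of K ?r E ?c] by blast
    define I :: "real \<times> real \<Rightarrow> real set" where "I i = {fst i..snd i}" for i
    let ?J = "\<lambda>i. F ` I i"
    have disj: "disjoint_family_on I C"
      using C(3) unfolding ball I_def disjoint_family_on_def pairwise_def disjnt_def by auto
    have disjJ: "disjoint_family_on ?J C"
      using disj strict_mono_imp_inj_on[OF mono] unfolding disjoint_family_on_def
      by (metis (no_types, lifting) image_Int image_empty)
    have Im: "I i \<in> sets lborel" "?J i \<in> sets lborel" for i by (auto simp: I_def Fi)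
    define N where "N = E - (\<Union>i\<in>C. I i)"
    have IU: "(\<Union>i\<in>C. I i) \<in> sets borel"
      using C(1) Im by (intro sets.countable_UN') auto
    have N: "negligible N" using C(4) unfolding N_def ball I_def .
    have "negligible (F ` N)"
      using N by (rule negligible_locally_Lipschitz_image[rotated])
        (auto simp: lip intro!: exI[of _ UNIV] exI[of _ L])
    moreover have FN: "F ` N \<in> sets borel" unfolding img N_def using measurable_sets_borel[of G borel "E - (\<Union>i\<in>C. I i)"] E IU by simp
    ultimately have N0: "emeasure lborel (F ` N) = 0"
      by (simp add: negligible_iff_null_sets null_sets_def)
    have JU: "(\<Union>i\<in>C. ?J i) \<in> sets lborel"
      using C(1) Im by (intro sets.countable_UN') auto
    have "emeasure lborel (F ` E) \<le> emeasure lborel (F ` N \<union> (\<Union>i\<in>C. ?J i))"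
      using FN JU by (intro emeasure_mono) (auto simp: N_def)
    also have "\<dots> \<le> emeasure lborel (F ` N) + emeasure lborel (\<Union>i\<in>C. ?J i)"
      using FN JU by (intro emeasure_subadditive) auto
    also have "\<dots> = (\<integral>\<^sup>+i. emeasure lborel (?J i) \<partial>count_space C)"
      using N0 emeasure_UN_countable[OF Im(2) C(1) disjJ] by simp
    also have "\<dots> \<le> (\<integral>\<^sup>+i. ennreal u * emeasure lborel (I i) \<partial>count_space C)"
    proof (rule nn_integral_mono)
      fix i assume "i \<in> space (count_space C)"
      then have "i \<in> K" using C by auto
      then obtain a b where i: "i = (a, b)" "a < b" "F b - F a \<le> u * (b - a)"
        by (auto simp: K_def)
      have "F a < F b" using i mono by (simp add: strict_mono_def)
      then show "emeasure lborel (?J i) \<le> ennreal u * emeasure lborel (I i)"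
        using i u by (simp add: I_def Fi ennreal_mult[symmetric] ennreal_leI)
    qed
    also have "\<dots> = ennreal u * emeasure lborel (\<Union>i\<in>C. I i)"
      using emeasure_UN_countable[OF Im(1) C(1) disj] by (simp add: nn_integral_cmult)
    also have "emeasure lborel (\<Union>i\<in>C. I i) \<le> emeasure lborel (E \<union> (T - E))"
      using C(2) E T by (intro emeasure_mono) (fastforce simp: K_def I_def, auto)
    also have "\<dots> \<le> emeasure lborel E + emeasure lborel (T - E)"
      using E T by (intro emeasure_subadditive) auto
    also have "emeasure lborel (T - E) \<le> ennreal e"
      using Te E T by (simp add: emeasure_completion less_imp_le)
    finally have "emeasure lborel (F ` E) \<le> ennreal u * (emeasure lborel E + ennreal e)"
      by (simp add: add_left_mono mult_left_mono)
    then show ?thesis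
      using u e by (simp add: distrib_left ennreal_mult)
  qed
  show "emeasure lborel (F ` E) \<le> ennreal u * emeasure lborel E"
  proof (rule ennreal_le_epsilon)
    fix e :: real assume "0 < e"
    have "ennreal (u * (e / (u + 1))) \<le> ennreal e"
      using u \<open>0 < e\<close> by (intro ennreal_leI) (auto simp: field_simps)
    then show "emeasure lborel (F ` E) \<le> ennreal u * emeasure lborel E + ennreal e"
      using order_trans[OF approx[of "e / (u + 1)"] add_left_mono] u \<open>0 < e\<close> by simp
  qed
qed

text \<open>
  Small slopes give \<open>|F E| \<le> u |E|\<close>. Large slopes of \<open>F\<close> are small slopes of its inverse, so they
  give \<open>|E| \<le> |F E| / v\<close>. Hence \<open>|E| \<le> (u / v) |E|\<close> with \<open>u / v < 1\<close>.\<close>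

lemma null_set_of_oscillating_slopes:
  fixes F :: "real \<Rightarrow> real"
  assumes lower: "\<And>x y. x \<le> y \<Longrightarrow> y - x \<le> F y - F x"
    and upper: "\<And>x y. x \<le> y \<Longrightarrow> F y - F x \<le> L * (y - x)"
    and E: "E \<in> sets borel" and uv: "0 < u" "u < v"
    and less: "\<And>x d. x \<in> E \<Longrightarrow> 0 < d \<Longrightarrow>
        \<exists>a b. a < b \<and> a \<le> x \<and> x \<le> b \<and> b - a < d \<and> F b - F a \<le> u * (b - a)"
    and greater: "\<And>x d. x \<in> E \<Longrightarrow> 0 < d \<Longrightarrow>
        \<exists>a b. a < b \<and> a \<le> x \<and> x \<le> b \<and> b - a < d \<and> F b - F a \<ge> v * (b - a)"
  shows "emeasure lborel E = 0"
proof -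
  have L: "L \<ge> 1" using lower[of 0 1] upper[of 0 1] by simp
  have lip: "\<bar>F x - F y\<bar> \<le> L * \<bar>x - y\<bar>" and colip: "\<bar>x - y\<bar> \<le> \<bar>F x - F y\<bar>" for x y
    using lower[of x y] upper[of x y] lower[of y x] upper[of y x] by (cases "x \<le> y"; simp add: abs_if)+
  have mono: "strict_mono F"
  proof (rule strict_monoI)
    fix x y :: real assume "x < y" then show "F x < F y" using lower[of x y] by simp
  qed
  have contF: "continuous_on A F" for A
    by (rule lipschitz_on_continuous_on[of L], rule lipschitz_onI) (use lip L in \<open>auto simp: dist_real_def\<close>)
  have "\<exists>x. F x = y" for y
  proof -
    define m where "m = \<bar>y - F 0\<bar>"
    have "F (-m) \<le> y" "y \<le> F m" "-m \<le> m"
      using lower[of 0 m] lower[of "-m" 0] unfolding m_def by auto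
    then show ?thesis using IVT'[of F "-m" y m] contF by blast
  qed
  then obtain G where FG: "\<And>y. F (G y) = y" by metis
  have GF: "G (F x) = x" for x
    using FG[of "F x"] strict_mono_eq[OF mono] by simp
  have Glip: "\<bar>G x - G y\<bar> \<le> 1 * \<bar>x - y\<bar>" for x y using colip[of "G x" "G y"] FG by simp
  have contG: "continuous_on A G" for A
    by (rule lipschitz_on_continuous_on[of 1], rule lipschitz_onI) (use Glip in \<open>auto simp: dist_real_def\<close>)
  have Gmono: "strict_mono G"
  proof (rule strict_monoI)
    fix x y :: real assume "x < y" then show "G x < G y" using strict_mono_less[OF mono, of "G x" "G y"] FG by simp
  qed
  \<comment> \<open>Intersecting with a bounded interval makes all measures finite.\<close>
  have null: "emeasure lborel (E \<inter> {-k..k}) = 0" for k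
  proof -
    define D where "D = E \<inter> {-k..k}"
    have D: "D \<in> sets borel" using E by (simp add: D_def)
    have fin: "emeasure lborel D < \<infinity>"
      using emeasure_mono[of D "{-k..k}" lborel] by (cases "-k \<le> k") (auto simp: D_def less_top[symmetric] top_unique)
    have FD: "F ` D \<in> sets borel" and le1: "emeasure lborel (F ` D) \<le> ennreal u * emeasure lborel D"
      using emeasure_image_le_of_small_slopes[OF GF FG mono lip contG D, of u] less uv
      by (auto simp: D_def)
    have "emeasure lborel (G ` F ` D) \<le> ennreal (1 / v) * emeasure lborel (F ` D)"
    proof (rule emeasure_image_le_of_small_slopes(2)[OF FG GF Gmono Glip contF FD])
      fix y d :: real assume y: "y \<in> F ` D" and d: "0 < d"
      then obtain x where x: "x \<in> E" "y = F x" by (auto simp: D_def)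
      obtain a b where ab: "a < b" "a \<le> x" "x \<le> b" "b - a < d / L" "F b - F a \<ge> v * (b - a)"
        using greater[OF x(1), of "d / L"] d L by auto
      have "F b - F a \<le> L * (b - a)" using upper ab by simp
      also have "\<dots> < d" using ab L by (simp add: field_simps)
      finally have "F b - F a < d" .
      then show "\<exists>a b. a < b \<and> a \<le> y \<and> y \<le> b \<and> b - a < d \<and> G b - G a \<le> 1 / v * (b - a)"
        using ab x uv mono
        by (intro exI[of _ "F a"] exI[of _ "F b"])
          (auto simp: GF strict_mono_less strict_mono_less_eq field_simps)
    qed (use uv in auto)
    also have "G ` F ` D = D" by (simp add: image_image GF)
    finally have "emeasure lborel D \<le> ennreal (1 / v) * (ennreal u * emeasure lborel D)"
      using le1 by (meson mult_left_mono order_trans zero_le)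
    also have "\<dots> = ennreal (u / v) * emeasure lborel D"
      using uv by (simp add: mult.assoc[symmetric] ennreal_mult[symmetric])
    finally have *: "emeasure lborel D \<le> ennreal (u / v) * emeasure lborel D" .
    obtain m where m: "emeasure lborel D = ennreal m" "m \<ge> 0" using fin by (cases "emeasure lborel D") auto
    have "m \<le> u / v * m" using * m uv by (simp add: ennreal_mult[symmetric])
    then have "m * (v - u) \<le> 0" using uv by (simp add: field_simps)
    then have "m \<le> 0" using uv by (simp add: mult_le_0_iff)
    then show ?thesis using m by (simp add: D_def)
  qed
  have "(\<Union>n. E \<inter> {- real n..real n}) \<in> null_sets lborel"
    using null E by (intro null_sets_UN) (auto simp: null_sets_def)
  moreover have "(\<Union>n. E \<inter> {- real n..real n}) = E"
  proof -
    have "\<exists>n. - real n \<le> x \<and> x \<le> real n" for x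
      using real_arch_simple[of "\<bar>x\<bar>"] by (metis abs_le_iff minus_le_iff)
    then show ?thesis by fastforce
  qed
  ultimately show ?thesis by auto
qed

text \<open>
  Widening the interval makes a one-sided difference quotient at \<open>x\<close> a slope over an interval with
  \<open>x\<close> in its interior. The set of points covered by such open intervals is open, which settles the
  measurability of the exceptional set below.\<close>

lemma ex_wider_interval_slope_in:
  fixes F :: "real \<Rightarrow> real"
  assumes cont: "continuous_on UNIV F" and P: "open P" "(F b - F a) / (b - a) \<in> P"
    and "a \<noteq> b" "d > 0"
  obtains a' b' where "\<bar>a' - a\<bar> < d" "\<bar>b' - b\<bar> < d" "a' < a" "b < b'" "(F b' - F a') / (b' - a') \<in> P"
proof -
  have c: "isCont F x" for x using cont by (simp add: continuous_on_eq_continuous_at)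
  have c': "isCont (\<lambda>t. F (x + t)) 0" "isCont (\<lambda>t. F (x - t)) 0" for x
    by (rule isCont_o2[OF _ c]; auto intro!: continuous_intros)+
  have "isCont (\<lambda>t. (F (b + t) - F (a - t)) / ((b + t) - (a - t))) 0"
    using assms by (intro continuous_intros c') auto
  then have "((\<lambda>t. (F (b + t) - F (a - t)) / ((b + t) - (a - t))) \<longlongrightarrow> (F b - F a) / (b - a)) (at_right 0)"
    by (simp add: isCont_def filterlim_at_split)
  then have "eventually (\<lambda>t. (F (b + t) - F (a - t)) / ((b + t) - (a - t)) \<in> P) (at_right 0)"
    using P by (rule topological_tendstoD)
  moreover have "eventually (\<lambda>t. t < d \<and> t > 0) (at_right 0)"
    using \<open>d > 0\<close> by (auto simp: eventually_at_right_field)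
  ultimately have "eventually (\<lambda>t. t < d \<and> t > 0 \<and> (F (b + t) - F (a - t)) / ((b + t) - (a - t)) \<in> P) (at_right 0)"
    by eventually_elim auto
  then obtain t where "t < d \<and> t > 0 \<and> (F (b + t) - F (a - t)) / ((b + t) - (a - t)) \<in> P"
    using eventually_happens'[OF trivial_limit_at_right_real] by blast
  then show ?thesis by (intro that[of "a - t" "b + t"]) auto
qed

text \<open>
  Where \<open>F\<close> is not differentiable, the lower limit of the difference quotients is smaller than the
  upper one, so two rationals fit between them and the point lies in one of countably many null
  sets \<open>E u v\<close>.\<close>

lemma AE_differentiable_of_bounded_slopes:
  fixes F :: "real \<Rightarrow> real"
  assumes lower: "\<And>x y. x \<le> y \<Longrightarrow> y - x \<le> F y - F x"
    and upper: "\<And>x y. x \<le> y \<Longrightarrow> F y - F x \<le> L * (y - x)"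
  shows "AE x in lborel. F differentiable (at x)"
proof -
  have L: "L \<ge> 1" using lower[of 0 1] upper[of 0 1] by simp
  have lip: "\<bar>F x - F y\<bar> \<le> L * \<bar>x - y\<bar>" for x y
    using lower[of x y] upper[of x y] lower[of y x] upper[of y x] by (cases "x \<le> y"; simp add: abs_if)
  have cont: "continuous_on UNIV F"
    by (rule lipschitz_on_continuous_on[of L], rule lipschitz_onI) (use lip L in \<open>auto simp: dist_real_def\<close>)
  define q where "q a b = (F b - F a) / (b - a)" for a b
  have q: "q a b \<in> {1..L}" if "a \<noteq> b" for a b
    using that lower[of a b] upper[of a b] lower[of b a] upper[of b a]
    by (cases "a < b") (auto simp: q_def field_simps)
  have q_sym: "q a b = q b a" for a b unfolding q_def by (metis minus_diff_eq minus_divide_divide)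
  define U where "U P n = {x. \<exists>a b. a < x \<and> x < b \<and> b - a < 1 / Suc n \<and> q a b \<in> P}" for P and n :: nat
  have openU: "open (U P n)" for P n
  proof -
    have "U P n = (\<Union>(a, b)\<in>{(a, b). b - a < 1 / Suc n \<and> q a b \<in> P}. {a<..<b})"
      unfolding U_def by (auto simp del: of_nat_Suc) blast
    then show ?thesis by auto
  qed
  define E where "E u v = (\<Inter>n. U {..<u} n) \<inter> (\<Inter>n. U {v<..} n)" for u v
  have Eborel: "E u v \<in> sets borel" for u v
    unfolding E_def using openU by (intro sets.Int sets.countable_INT) auto
  have null: "E u v \<in> null_sets lborel" if "0 < u" "u < v" for u v
  proof -
    have "emeasure lborel (E u v) = 0"
    proof (rule null_set_of_oscillating_slopes[OF lower upper Eborel that])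
      fix x d :: real assume x: "x \<in> E u v" and "0 < d"
      then obtain n where n: "1 / Suc n < d" using nat_approx_posE by blast
      from x have "x \<in> U {..<u} n" "x \<in> U {v<..} n" by (auto simp: E_def)
      then obtain a b a' b' where ab: "a < x" "x < b" "b - a < 1 / Suc n" "q a b < u"
        and ab': "a' < x" "x < b'" "b' - a' < 1 / Suc n" "v < q a' b'"
        by (auto simp: U_def simp del: of_nat_Suc)
      have "F b - F a \<le> u * (b - a)" "F b' - F a' \<ge> v * (b' - a')"
        using ab ab' by (auto simp: q_def field_simps)
      then show "\<exists>a b. a < b \<and> a \<le> x \<and> x \<le> b \<and> b - a < d \<and> F b - F a \<le> u * (b - a)"
        "\<exists>a b. a < b \<and> a \<le> x \<and> x \<le> b \<and> b - a < d \<and> F b - F a \<ge> v * (b - a)"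
        using ab ab' n by (meson less_trans less_imp_le)+
    qed auto
    then show ?thesis using Eborel by auto
  qed
  have diff: "F differentiable (at x)"
    if not: "\<And>r s :: rat. 0 < r \<Longrightarrow> r < s \<Longrightarrow> x \<notin> E (of_rat r) (of_rat s)" for x
  proof -
    have inU: "x \<in> U P n" if "open P" "frequently (\<lambda>y. q x y \<in> P) (at x)" for P n
    proof -
      have "eventually (\<lambda>y. y \<noteq> x \<and> dist y x < 1 / Suc n / 3) (at x)"
        by (auto simp: eventually_at intro!: exI[of _ "1 / Suc n / 3"])
      with that(2) have "frequently (\<lambda>y. q x y \<in> P \<and> y \<noteq> x \<and> dist y x < 1 / Suc n / 3) (at x)"
        by (rule frequently_eventually_frequently)
      then obtain y where y: "q x y \<in> P" "y \<noteq> x" "\<bar>y - x\<bar> < 1 / Suc n / 3"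
        by (auto dest!: frequently_ex simp: dist_real_def)
      obtain a b where ab: "a < b" "{a, b} = {x, y}" "a \<le> x" "x \<le> b" "q a b \<in> P" "b - a < 1 / Suc n / 3"
      proof (cases "x < y")
        case True
        with y show ?thesis by (intro that[of x y]) (auto simp: abs_less_iff)
      next
        case False
        with y q_sym[of x y] show ?thesis
          by (intro that[of y x]) (auto simp: insert_commute abs_less_iff)
      qed
      obtain a' b' where "\<bar>a' - a\<bar> < 1 / Suc n / 3" "\<bar>b' - b\<bar> < 1 / Suc n / 3" "a' < a" "b < b'" "q a' b' \<in> P"
        using ex_wider_interval_slope_in[OF cont \<open>open P\<close>, of b a "1 / Suc n / 3"] ab by (auto simp: q_def)
      with ab have "a' < x" "x < b'" "b' - a' < 1 / Suc n"
        by linarith+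
      with \<open>q a' b' \<in> P\<close> show ?thesis by (auto simp: U_def)
    qed
    let ?q = "\<lambda>y. ereal (q x y)"
    have ev: "eventually (\<lambda>y. q x y \<in> {1..L}) (at x)"
      using q by (auto simp: eventually_at_filter)
    have lo: "1 \<le> Liminf (at x) ?q"
      using ev by (intro Liminf_bounded) (auto elim: eventually_mono)
    have hi: "Limsup (at x) ?q \<le> L"
      using ev by (intro Limsup_bounded) (auto elim: eventually_mono)
    have le: "Liminf (at x) ?q \<le> Limsup (at x) ?q" by (intro Liminf_le_Limsup) simp
    have "Limsup (at x) ?q \<le> Liminf (at x) ?q"
    proof (rule ccontr)
      assume "\<not> Limsup (at x) ?q \<le> Liminf (at x) ?q"
      then obtain s where s: "Liminf (at x) ?q < real_of_rat s" "real_of_rat s < Limsup (at x) ?q"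
        using ereal_dense3 by (meson not_le)
      obtain r where r: "Liminf (at x) ?q < real_of_rat r" "real_of_rat r < ereal (real_of_rat s)"
        using ereal_dense3[OF s(1)] by blast
      have "1 < ereal (real_of_rat r)" using lo r(1) by (rule le_less_trans)
      then have "0 < real_of_rat r" by (simp add: one_ereal_def)
      have "frequently (\<lambda>y. q x y \<in> {..<real_of_rat r}) (at x)"
      proof (rule ccontr)
        assume "\<not> ?thesis"
        then have "eventually (\<lambda>y. ereal (real_of_rat r) \<le> ?q y) (at x)"
          by (simp add: frequently_def not_less)
        from Liminf_bounded[OF this] r show False by simp
      qed
      moreover have "frequently (\<lambda>y. q x y \<in> {real_of_rat s<..}) (at x)"
      proof (rule ccontr)
        assume "\<not> ?thesis"
        then have "eventually (\<lambda>y. ?q y \<le> ereal (real_of_rat s)) (at x)"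
          by (simp add: frequently_def not_less)
        from Limsup_bounded[OF this] s show False by simp
      qed
      ultimately have "x \<in> E (of_rat r) (of_rat s)"
        unfolding E_def by (auto intro!: inU)
      moreover have "0 < r" "r < s"
        using \<open>0 < real_of_rat r\<close> r(2) by (auto simp: of_rat_less)
      ultimately show False using not by blast
    qed
    then have eq: "Liminf (at x) ?q = Limsup (at x) ?q" using le by simp
    moreover obtain D where D: "Limsup (at x) ?q = ereal D"
      using lo hi le by (cases "Limsup (at x) ?q") auto
    ultimately have "(?q \<longlongrightarrow> ereal D) (at x)"
      by (subst tendsto_iff_Liminf_eq_Limsup) auto
    then have "((\<lambda>y. (F y - F x) / (y - x)) \<longlongrightarrow> D) (at x)" by (simp add: q_def)
    then have "(F has_field_derivative D) (at x)" by (simp add: has_field_derivative_iff)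
    then show ?thesis using real_differentiable_def by blast
  qed
  have "(\<Union>(r, s)\<in>{(r, s). 0 < r \<and> r < s}. E (real_of_rat r) (real_of_rat s)) \<in> null_sets lborel"
    by (intro null_sets_UN') (auto intro!: null simp: of_rat_less)
  then show ?thesis
    by (rule AE_I') (use diff in \<open>auto\<close>)
qed

text \<open>
  Adding a large multiple of the identity makes all slopes at least 1.\<close>

lemma AE_differentiable_of_lipschitz:
  fixes f :: "real \<Rightarrow> real"
  assumes lip: "\<And>x y. \<bar>f x - f y\<bar> \<le> C * \<bar>x - y\<bar>"
  shows "AE x in lborel. f differentiable (at x)"
proof -
  have "AE x in lborel. (\<lambda>x. f x + (C + 1) * x) differentiable (at x)"
  proof (rule AE_differentiable_of_bounded_slopes)
    fix x y :: real assume "x \<le> y"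
    then show "y - x \<le> (f y + (C + 1) * y) - (f x + (C + 1) * x)"
      "(f y + (C + 1) * y) - (f x + (C + 1) * x) \<le> (2 * C + 1) * (y - x)"
      using lip[of y x] by (auto simp: algebra_simps abs_le_iff)
  qed
  then show ?thesis
  proof eventually_elim
    fix x assume "(\<lambda>x. f x + (C + 1) * x) differentiable (at x)"
    then have "(\<lambda>x. (f x + (C + 1) * x) - (C + 1) * x) differentiable (at x)"
      by (intro differentiable_diff) auto
    then show "f differentiable (at x)" by simp
  qed
qed

section \<open>The logarithmic energy of circles\<close>

lemma sin_ge_half: "x / 2 \<le> sin x" if "0 \<le> x" "x \<le> pi / 2" for x :: real
proof -
  have *: "y * cos y \<le> sin y" if y: "0 \<le> y" "y \<le> pi / 2" for y :: real
  proof (cases "y = 0")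
    case False
    then obtain c where c: "0 < c" "c < y" "sin y - sin 0 = (y - 0) * cos c"
      using MVT2[of 0 y sin cos] y by (auto intro!: derivative_eq_intros)
    have "cos y \<le> cos c" using c y by (intro cos_monotone_0_pi_le) auto
    with c y show ?thesis by (simp add: mult_left_mono)
  qed auto
  have "x / 2 \<le> x / 2 * (1 + cos x)"
    using that cos_ge_zero[of x] by (simp add: mult_le_cancel_left1)
  also have "\<dots> = 2 * (x / 2 * cos (x / 2)) * cos (x / 2)"
    using cos_double_cos[of "x / 2"] by (simp add: power2_eq_square algebra_simps)
  also have "\<dots> \<le> 2 * sin (x / 2) * cos (x / 2)"
    using that *[of "x / 2"] cos_ge_zero[of "x / 2"] by (intro mult_right_mono) auto
  also have "\<dots> = sin x" using sin_double[of "x / 2"] by simp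
  finally show ?thesis .
qed

lemma dist_cis: "dist (cis s) (cis t) = 2 * \<bar>sin ((s - t) / 2)\<bar>"
proof -
  have "(dist (cis s) (cis t))\<^sup>2 = (cos s - cos t)\<^sup>2 + (sin s - sin t)\<^sup>2"
    by (simp add: dist_norm cmod_power2)
  also have "\<dots> = ((cos s)\<^sup>2 + (sin s)\<^sup>2) + ((cos t)\<^sup>2 + (sin t)\<^sup>2) - 2 * (cos s * cos t + sin s * sin t)"
    by (simp add: power2_eq_square algebra_simps)
  also have "\<dots> = 2 - 2 * cos (s - t)" by (simp add: cos_diff)
  also have "cos (s - t) = 1 - 2 * (sin ((s - t) / 2))\<^sup>2"
    using cos_double_sin[of "(s - t) / 2"] by (simp only: mult_2 field_sum_of_halves)
  finally have "(dist (cis s) (cis t))\<^sup>2 = (2 * \<bar>sin ((s - t) / 2)\<bar>)\<^sup>2"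
    by (simp add: power_mult_distrib)
  then show ?thesis by (intro power2_eq_imp_eq[of "dist (cis s) (cis t)"]) auto
qed

text \<open>
  The distance of two points on the unit circle is comparable to the distance of their angles
  modulo \<open>2 * pi\<close>; the minimum runs over the three representatives of the angle difference that can
  matter.\<close>

lemma dist_cis_ge:
  assumes s: "s \<in> {0..2 * pi}" and t: "t \<in> {0..2 * pi}"
  shows "min \<bar>s - t\<bar> (min \<bar>s - t + 2 * pi\<bar> \<bar>s - t - 2 * pi\<bar>) / 2 \<le> dist (cis s) (cis t)"
proof -
  define v where "v = \<bar>s - t\<bar> / 2"
  have v2: "\<bar>s - t\<bar> = 2 * v" by (simp add: v_def)
  have v: "0 \<le> v" "v \<le> pi" using s t by (auto simp: v_def)
  have sinv: "\<bar>sin ((s - t) / 2)\<bar> = sin v"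
  proof -
    have "sin v \<ge> 0" using v by (intro sin_ge_zero)
    moreover have "sin v = sin ((s - t) / 2) \<or> sin v = - sin ((s - t) / 2)"
    proof (cases "t \<le> s")
      case False
      then have "v = - ((s - t) / 2)" using v2 by (simp add: abs_if field_simps)
      then show ?thesis using sin_minus[of "(s - t) / 2"] by metis
    qed (simp add: v_def)
    ultimately show ?thesis by auto
  qed
  have "min v (pi - v) / 2 \<le> sin v"
  proof (cases "v \<le> pi / 2")
    case True
    then show ?thesis using sin_ge_half[of v] v by simp
  next
    case False
    then show ?thesis using sin_ge_half[of "pi - v"] v by (simp add: min_def)
  qed
  moreover have "min \<bar>s - t\<bar> (min \<bar>s - t + 2 * pi\<bar> \<bar>s - t - 2 * pi\<bar>) \<le> 2 * min v (pi - v)"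
  proof -
    have "\<bar>s - t + 2 * pi\<bar> = 2 * (pi - v) \<or> \<bar>s - t - 2 * pi\<bar> = 2 * (pi - v)"
      using s t v2 by (cases "t \<le> s") auto
    then show ?thesis using v2 by (auto simp: min_def)
  qed
  ultimately show ?thesis unfolding dist_cis sinv by simp
qed

lemma minus_ln_le_powr: "- ln x \<le> 2 * x powr (- 1 / 2)" if "0 < x" for x :: real
proof -
  have "ln (x powr (- 1 / 2)) \<le> x powr (- 1 / 2) - 1" using that by (intro ln_le_minus_one) simp
  then show ?thesis using that by (simp add: ln_powr)
qed

text \<open>
  The logarithmic singularity is dominated by an inverse square root, whose integral over an
  interval is explicit. The interval is large enough for all translates needed below.\<close>

definition sqrt_sing :: ennreal where
  "sqrt_sing = (\<integral>\<^sup>+w. ennreal (\<bar>w\<bar> powr (- 1 / 2)) * indicator {- 4 * pi..4 * pi} w \<partial>lborel)"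

lemma sqrt_sing_finite: "sqrt_sing < \<infinity>"
proof -
  let ?f = "\<lambda>w::real. ennreal (w powr (- 1 / 2)) * indicator {0..4 * pi} w"
  have "((\<lambda>x::real. x powr (- 1 / 2)) has_integral ((4 * pi) powr (- 1 / 2 + 1) / (- 1 / 2 + 1))) {0..4 * pi}"
    by (rule has_integral_powr_from_0) auto
  then have "(\<integral>\<^sup>+w. ennreal (w powr (- 1 / 2)) * indicator {0..4 * pi} w \<partial>lborel)
      = ennreal ((4 * pi) powr (- 1 / 2 + 1) / (- 1 / 2 + 1))"
    by (intro nn_integral_has_integral_lebesgue') auto
  then have fin: "integral\<^sup>N lborel ?f < \<infinity>" by simp
  have "sqrt_sing \<le> (\<integral>\<^sup>+w. ?f w + ?f (0 + (- 1) * w) \<partial>lborel)"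
    unfolding sqrt_sing_def by (intro nn_integral_mono) (auto simp: indicator_def abs_if)
  also have "\<dots> = integral\<^sup>N lborel ?f + (\<integral>\<^sup>+w. ?f (0 + (- 1) * w) \<partial>lborel)"
    by (intro nn_integral_add) auto
  also have "(\<integral>\<^sup>+w. ?f (0 + (- 1) * w) \<partial>lborel) = integral\<^sup>N lborel ?f"
    using nn_integral_real_affine[of ?f "-1" 0] by simp
  finally show ?thesis using fin by (auto simp: less_top[symmetric] top_unique)
qed

lemma nn_integral_shifted_sqrt_sing:
  assumes "a \<in> {- 2 * pi..4 * pi}"
  shows "(\<integral>\<^sup>+t. ennreal (\<bar>a - t\<bar> powr (- 1 / 2)) * indicator {0..2 * pi} t \<partial>lborel) \<le> sqrt_sing"
proof -
  let ?f = "\<lambda>w::real. ennreal (\<bar>w\<bar> powr (- 1 / 2)) * indicator {- 4 * pi..4 * pi} w"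
  have "(\<integral>\<^sup>+t. ennreal (\<bar>a - t\<bar> powr (- 1 / 2)) * indicator {0..2 * pi} t \<partial>lborel)
      \<le> (\<integral>\<^sup>+t. ?f (a + (- 1) * t) \<partial>lborel)"
    using assms by (intro nn_integral_mono) (auto simp: indicator_def)
  also have "\<dots> = sqrt_sing"
    using nn_integral_real_affine[of ?f "-1" a] by (simp add: sqrt_sing_def)
  finally show ?thesis .
qed

abbreviation angle :: "real measure" where "angle \<equiv> uniform_measure lborel {0..2 * pi}"

lemma prob_space_angle: "prob_space angle"
  by (rule prob_space_uniform_measure) auto

lemma AE_angle: "AE t in angle. t \<in> {0..2 * pi}"
  by (rule AE_uniform_measureI) auto

lemma sets_circle_measure [simp, measurable_cong]: "sets (circle_measure z r) = sets borel"
  by (simp add: circle_measure_def)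

lemma circle_param_measurable [measurable]:
  "(\<lambda>t. z + of_real r * cis t) \<in> borel_measurable borel"
  by (intro borel_measurable_continuous_onI continuous_intros)

lemma prob_space_circle_measure: "prob_space (circle_measure z r)"
  unfolding circle_measure_def
  by (intro prob_space.prob_space_distr prob_space_angle) simp

lemma nn_integral_circle_measure:
  assumes [measurable]: "f \<in> borel_measurable borel"
  shows "(\<integral>\<^sup>+x. f x \<partial>circle_measure z r) = (\<integral>\<^sup>+t. f (z + of_real r * cis t) \<partial>angle)"
  unfolding circle_measure_def by (intro nn_integral_distr) auto

lemma nn_integral_circle_pair:
  assumes [measurable]: "f \<in> borel_measurable (borel \<Otimes>\<^sub>M borel)"
  shows "(\<integral>\<^sup>+p. f p \<partial>(circle_measure z r \<Otimes>\<^sub>M circle_measure w r')) =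
    (\<integral>\<^sup>+s. \<integral>\<^sup>+t. f (z + of_real r * cis s, w + of_real r' * cis t) \<partial>angle \<partial>angle)"
proof -
  interpret W: prob_space "circle_measure w r'" by (rule prob_space_circle_measure)
  have [measurable]: "f \<in> borel_measurable (borel \<Otimes>\<^sub>M circle_measure w r')"
    using measurable_cong_sets[OF sets_pair_measure_cong[of borel borel "circle_measure w r'" borel] refl, of borel]
    by simp
  have "(\<integral>\<^sup>+p. f p \<partial>(circle_measure z r \<Otimes>\<^sub>M circle_measure w r'))
     = (\<integral>\<^sup>+x. \<integral>\<^sup>+y. f (x, y) \<partial>circle_measure w r' \<partial>circle_measure z r)"
    by (intro W.nn_integral_fst[symmetric]) measurable
  also have "\<dots> = (\<integral>\<^sup>+s. \<integral>\<^sup>+y. f (z + of_real r * cis s, y) \<partial>circle_measure w r' \<partial>angle)"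
    by (rule nn_integral_circle_measure) (rule W.borel_measurable_nn_integral_fst, measurable)
  also have "\<dots> = (\<integral>\<^sup>+s. \<integral>\<^sup>+t. f (z + of_real r * cis s, w + of_real r' * cis t) \<partial>angle \<partial>angle)"
    by (intro nn_integral_cong nn_integral_circle_measure) measurable
  finally show ?thesis .
qed

definition log_kernel :: "complex \<times> complex \<Rightarrow> ennreal" where
  "log_kernel = (\<lambda>(x, y). if x = y then \<infinity> else ennreal (- ln (dist x y)))"

lemma log_kernel_measurable [measurable]: "log_kernel \<in> borel_measurable (borel \<Otimes>\<^sub>M borel)"
  unfolding log_kernel_def by measurable

text \<open>
  The summand \<open>ln 2\<close> is the loss of the factor 2 in the comparison of distances and angles. The
  three representatives of the angle difference each contribute \<open>2 * sqrt_sing\<close>, and \<open>2 * pi\<close>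
  normalizes the uniform measure on the angles.\<close>

definition circle_energy_const :: real where
  "circle_energy_const = ln 2 + 6 * enn2real sqrt_sing / (2 * pi)"

lemma circle_energy_const_nonneg: "0 \<le> circle_energy_const"
  by (simp add: circle_energy_const_def)

lemma log_kernel_circle_le:
  assumes r: "0 < r" "r \<le> 1" and s: "s \<in> {0..2 * pi}" and t: "t \<in> {0..2 * pi}"
    and nt: "t \<notin> {s, s + 2 * pi, s - 2 * pi}"
  shows "log_kernel (z + of_real r * cis s, z + of_real r * cis t) \<le>
    ennreal (ln 2 - ln r) + 2 * (ennreal (\<bar>s - t\<bar> powr (- 1 / 2)) +
      ennreal (\<bar>(s + 2 * pi) - t\<bar> powr (- 1 / 2)) + ennreal (\<bar>(s - 2 * pi) - t\<bar> powr (- 1 / 2)))"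
proof -
  define m where "m = min \<bar>s - t\<bar> (min \<bar>s - t + 2 * pi\<bar> \<bar>s - t - 2 * pi\<bar>)"
  define d where "d = dist (cis s) (cis t)"
  have m: "0 < m" using nt by (auto simp: m_def)
  have md: "m / 2 \<le> d" unfolding m_def d_def by (rule dist_cis_ge[OF s t])
  have d: "0 < d" using m md by simp
  have dist: "dist (z + of_real r * cis s) (z + of_real r * cis t) = r * d"
    using r by (simp add: d_def dist_norm flip: right_diff_distrib norm_mult) (simp add: norm_mult)
  have "- ln (r * d) = - ln r - ln d" using r d by (simp add: ln_mult)
  also have "\<dots> \<le> - ln r - ln (m / 2)" using md m by simp
  also have "\<dots> \<le> (ln 2 - ln r) + 2 * m powr (- 1 / 2)"
    using minus_ln_le_powr[OF m] m by (simp add: ln_div)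
  also have "m powr (- 1 / 2) \<le> \<bar>s - t\<bar> powr (- 1 / 2) + \<bar>(s + 2 * pi) - t\<bar> powr (- 1 / 2) + \<bar>(s - 2 * pi) - t\<bar> powr (- 1 / 2)"
  proof -
    have "m = \<bar>s - t\<bar> \<or> m = \<bar>(s + 2 * pi) - t\<bar> \<or> m = \<bar>(s - 2 * pi) - t\<bar>"
      unfolding m_def min_def by (auto simp: algebra_simps)
    then show ?thesis by (elim disjE) (auto intro!: add_nonneg_nonneg)
  qed
  finally have le: "- ln (r * d) \<le> (ln 2 - ln r) + 2 * (\<bar>s - t\<bar> powr (- 1 / 2) +
      \<bar>(s + 2 * pi) - t\<bar> powr (- 1 / 2) + \<bar>(s - 2 * pi) - t\<bar> powr (- 1 / 2))" by simp
  have "ln r \<le> ln 2" using r by simp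
  then have "ennreal (ln 2 - ln r) + 2 * (ennreal (\<bar>s - t\<bar> powr (- 1 / 2)) +
      ennreal (\<bar>(s + 2 * pi) - t\<bar> powr (- 1 / 2)) + ennreal (\<bar>(s - 2 * pi) - t\<bar> powr (- 1 / 2)))
    = ennreal ((ln 2 - ln r) + 2 * (\<bar>s - t\<bar> powr (- 1 / 2) +
      \<bar>(s + 2 * pi) - t\<bar> powr (- 1 / 2) + \<bar>(s - 2 * pi) - t\<bar> powr (- 1 / 2)))"
    by (simp only: ennreal_plus ennreal_mult ennreal_numeral add_nonneg_nonneg zero_le_numeral
        powr_ge_zero mult_nonneg_nonneg diff_ge_0_iff_ge)
  moreover have "z + of_real r * cis s \<noteq> z + of_real r * cis t"
    using r d by (auto simp: d_def)
  ultimately show ?thesis using ennreal_leI[OF le] unfolding log_kernel_def dist prod.case by (simp only: if_False)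
qed

lemma nn_integral_angle:
  assumes [measurable]: "f \<in> borel_measurable borel"
  shows "(\<integral>\<^sup>+t. f t \<partial>angle) = (\<integral>\<^sup>+t. f t * indicator {0..2 * pi} t \<partial>lborel) / ennreal (2 * pi)"
  using nn_integral_uniform_measure[of f lborel "{0..2 * pi}"] by simp

text \<open>
  This one estimate gives both that circles are admissible test measures for the field and that
  the circle averages have variance at most \<open>log (1/r)\<close> up to a constant.\<close>

lemma circle_energy_le:
  assumes r: "0 < r" "r \<le> 1"
  shows "(\<integral>\<^sup>+p. log_kernel p \<partial>(circle_measure z r \<Otimes>\<^sub>M circle_measure z r))
    \<le> ennreal (- ln r + circle_energy_const)"
proof -
  obtain c where c: "sqrt_sing = ennreal c" "c \<ge> 0" using sqrt_sing_finite by (cases sqrt_sing) auto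
  have lnr: "ln r \<le> 0" using r by simp
  have inner: "(\<integral>\<^sup>+t. log_kernel (z + of_real r * cis s, z + of_real r * cis t) \<partial>angle)
      \<le> ennreal (- ln r + circle_energy_const)" if s: "s \<in> {0..2 * pi}" for s
  proof -
    let ?g = "\<lambda>a t. ennreal (\<bar>a - t\<bar> powr (- 1 / 2)) * indicator {0..2 * pi} t"
    have "(\<integral>\<^sup>+t. log_kernel (z + of_real r * cis s, z + of_real r * cis t) * indicator {0..2 * pi} t \<partial>lborel)
      \<le> (\<integral>\<^sup>+t. ennreal (ln 2 - ln r) * indicator {0..2 * pi} t + 2 * (?g s t + ?g (s + 2 * pi) t + ?g (s - 2 * pi) t) \<partial>lborel)"
    proof (rule nn_integral_mono_AE)
      have "AE t in lborel. t \<notin> {s, s + 2 * pi, s - 2 * pi}"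
        by (intro AE_not_in finite_imp_null_set_lborel) auto
      then show "AE t in lborel. log_kernel (z + of_real r * cis s, z + of_real r * cis t) * indicator {0..2 * pi} t
        \<le> ennreal (ln 2 - ln r) * indicator {0..2 * pi} t + 2 * (?g s t + ?g (s + 2 * pi) t + ?g (s - 2 * pi) t)"
      proof eventually_elim
        case (elim t)
        show ?case
          using log_kernel_circle_le[OF r s _ elim, of z] by (cases "t \<in> {0..2 * pi}") auto
      qed
    qed
    also have "\<dots> = ennreal (ln 2 - ln r) * ennreal (2 * pi) + 2 * (integral\<^sup>N lborel (?g s) + integral\<^sup>N lborel (?g (s + 2 * pi)) + integral\<^sup>N lborel (?g (s - 2 * pi)))"
      by (simp add: nn_integral_add nn_integral_cmult nn_integral_cmult_indicator)
    also have "\<dots> \<le> ennreal (ln 2 - ln r) * ennreal (2 * pi) + 2 * (sqrt_sing + sqrt_sing + sqrt_sing)"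
      using s by (intro add_left_mono mult_left_mono add_mono nn_integral_shifted_sqrt_sing) auto
    also have "\<dots> = ennreal ((ln 2 - ln r) * (2 * pi) + 6 * c)"
    proof -
      have "0 \<le> ln 2 - ln r" using lnr ln_gt_zero[of "2::real"] by linarith
      then have "ennreal ((ln 2 - ln r) * (2 * pi) + 6 * c)
          = ennreal (ln 2 - ln r) * ennreal (2 * pi) + ennreal 6 * ennreal c"
        using c(2) by (simp only: ennreal_plus ennreal_mult mult_nonneg_nonneg pi_ge_zero zero_le_numeral)
      also have "ennreal 6 * ennreal c = ennreal (2 * (c + c + c))"
        using c(2) by (subst ennreal_mult[symmetric]) auto
      also have "\<dots> = 2 * (ennreal c + ennreal c + ennreal c)"
        using c(2) by (simp only: ennreal_plus ennreal_mult ennreal_numeral add_nonneg_nonneg zero_le_numeral)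
      finally show ?thesis by (simp add: c(1))
    qed
    finally have "(\<integral>\<^sup>+t. log_kernel (z + of_real r * cis s, z + of_real r * cis t) \<partial>angle)
      \<le> ennreal ((ln 2 - ln r) * (2 * pi) + 6 * c) / ennreal (2 * pi)"
      by (subst nn_integral_angle) (auto intro!: divide_right_mono_ennreal)
    also have "\<dots> = ennreal (- ln r + circle_energy_const)"
    proof (subst divide_ennreal)
      show "0 \<le> (ln 2 - ln r) * (2 * pi) + 6 * c"
      proof -
        have "0 \<le> ln 2 - ln r" using lnr ln_gt_zero[of "2::real"] by linarith
        then show ?thesis using c(2) by simp
      qed
      show "ennreal (((ln 2 - ln r) * (2 * pi) + 6 * c) / (2 * pi)) = ennreal (- ln r + circle_energy_const)"
        using c(2) unfolding circle_energy_const_def c(1) enn2real_ennreal[OF c(2)]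
        by (intro arg_cong[of _ _ ennreal]) (simp add: field_simps)
    qed simp
    finally show ?thesis .
  qed
  have "(\<integral>\<^sup>+p. log_kernel p \<partial>(circle_measure z r \<Otimes>\<^sub>M circle_measure z r)) =
     (\<integral>\<^sup>+s. \<integral>\<^sup>+t. log_kernel (z + of_real r * cis s, z + of_real r * cis t) \<partial>angle \<partial>angle)"
    by (rule nn_integral_circle_pair[OF log_kernel_measurable])
  also have "\<dots> \<le> (\<integral>\<^sup>+s. ennreal (- ln r + circle_energy_const) \<partial>angle)"
  proof (rule nn_integral_mono_AE)
    show "AE s in angle. (\<integral>\<^sup>+t. log_kernel (z + of_real r * cis s, z + of_real r * cis t) \<partial>angle)
        \<le> ennreal (- ln r + circle_energy_const)"
      using AE_angle by eventually_elim (rule inner)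
  qed
  also have "\<dots> = ennreal (- ln r + circle_energy_const)"
    using prob_space.emeasure_space_1[OF prob_space_angle] by simp
  finally show ?thesis .
qed

lemma circle_measure_in_field_index:
  assumes "0 < r" "r \<le> 1" shows "circle_measure z r \<in> field_index"
proof -
  interpret prob_space "circle_measure z r" by (rule prob_space_circle_measure)
  have "norm (z + of_real r * cis t) \<le> norm z + r" for t
    using norm_triangle_ineq[of z "of_real r * cis t"] assms by (simp add: norm_mult)
  then have "(\<lambda>t. z + of_real r * cis t) -` (- cball 0 (norm z + r)) = {}"
    by auto
  then have "emeasure (circle_measure z r) (- cball 0 (norm z + r)) = 0"
    unfolding circle_measure_def by (subst emeasure_distr) auto
  moreover have "finite_log_energy (circle_measure z r)"
    using le_less_trans[OF circle_energy_le[OF assms, of z] ennreal_less_top]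
    unfolding finite_log_energy_def log_kernel_def by simp
  ultimately show ?thesis
    unfolding field_index_def using finite_measure_axioms by auto
qed

lemma circle_log_energy_le:
  assumes "0 < r" "r \<le> 1"
  shows "log_energy (circle_measure z r) (circle_measure z r) \<le> - ln r + circle_energy_const"
  unfolding log_energy_def
proof (rule integral_real_bounded)
  show "0 \<le> - ln r + circle_energy_const" using ln_le_zero_iff[of r] assms circle_energy_const_nonneg by linarith
  show "(\<integral>\<^sup>+p. ennreal (case p of (x, y) \<Rightarrow> - ln (dist x y)) \<partial>(circle_measure z r \<Otimes>\<^sub>M circle_measure z r))
    \<le> ennreal (- ln r + circle_energy_const)"
    by (rule order_trans[OF nn_integral_mono circle_energy_le[OF assms]])
      (auto simp: log_kernel_def split: prod.splits)
qed



text \<open>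
  The kernel is bounded below on bounded sets. As \<open>ln R \<ge> 0\<close>, it is enough to bound the integral of
  the positive part of the logarithm.\<close>

lemma circle_log_energy_ge:
  assumes R: "1 \<le> R" "dist z w + \<bar>r\<bar> + \<bar>r'\<bar> \<le> R"
  shows "- ln R \<le> log_energy (circle_measure z r) (circle_measure w r')"
proof -
  have "(\<integral>(x, y). ln (dist x y) \<partial>(circle_measure z r \<Otimes>\<^sub>M circle_measure w r')) \<le> ln R"
  proof (rule integral_real_bounded)
    show "0 \<le> ln R" using R by simp
    have "ln (dist (z + of_real r * cis s) (w + of_real r' * cis t)) \<le> ln R" for s t
    proof -
      have "dist (z + of_real r * cis s) (w + of_real r' * cis t)
        = norm ((z - w) + of_real r * cis s - of_real r' * cis t)"
        by (simp add: dist_norm algebra_simps)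
      also have "\<dots> \<le> norm (z - w) + norm (of_real r * cis s) + norm (of_real r' * cis t)"
        by (meson norm_triangle_ineq norm_triangle_ineq4 add_mono order_trans order_refl)
      also have "\<dots> \<le> R" using R by (simp add: dist_norm norm_mult)
      finally show ?thesis using R
        by (cases "dist (z + of_real r * cis s) (w + of_real r' * cis t) = 0") auto
    qed
    then have "(\<integral>\<^sup>+s. \<integral>\<^sup>+t. ennreal (ln (dist (z + of_real r * cis s) (w + of_real r' * cis t))) \<partial>angle \<partial>angle)
      \<le> (\<integral>\<^sup>+s. \<integral>\<^sup>+t. ennreal (ln R) \<partial>angle \<partial>angle)"
      by (intro nn_integral_mono ennreal_leI)
    also have "\<dots> = ennreal (ln R)"
      using prob_space.emeasure_space_1[OF prob_space_angle] by simp
    finally show "(\<integral>\<^sup>+p. ennreal (case p of (x, y) \<Rightarrow> ln (dist x y)) \<partial>(circle_measure z r \<Otimes>\<^sub>M circle_measure w r'))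
      \<le> ennreal (ln R)"
      by (subst nn_integral_circle_pair) auto
  qed
  moreover have "log_energy (circle_measure z r) (circle_measure w r') =
      - (\<integral>(x, y). ln (dist x y) \<partial>(circle_measure z r \<Otimes>\<^sub>M circle_measure w r'))"
    unfolding log_energy_def by (simp add: case_prod_unfold)
  ultimately show ?thesis by simp
qed

section \<open>Exponential moments of circle averages\<close>

lemma nn_integral_exp_centered_gaussian:
  assumes X: "centered_gaussian M X v" and M: "prob_space M"
  shows "(\<integral>\<^sup>+\<omega>. ennreal (exp (q * X \<omega>)) \<partial>M) = ennreal (exp (q\<^sup>2 / 2 * v))"
proof -
  interpret prob_space M by fact
  from X consider "v = 0" "AE \<omega> in M. X \<omega> = 0"
    | "v > 0" "distributed M lborel X (normal_density 0 (sqrt v))"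
    by (auto simp: centered_gaussian_def)
  then show ?thesis
  proof cases
    case 1
    have "(\<integral>\<^sup>+\<omega>. ennreal (exp (q * X \<omega>)) \<partial>M) = (\<integral>\<^sup>+\<omega>. 1 \<partial>M)"
      using 1 by (intro nn_integral_cong_AE) auto
    then show ?thesis using 1 emeasure_space_1 by simp
  next
    case 2
    \<comment> \<open>completing the square: an exponential tilt shifts the mean\<close>
    have ident: "normal_density 0 (sqrt v) x * exp (q * x) = exp (q\<^sup>2 / 2 * v) * normal_density (q * v) (sqrt v) x" for x
    proof -
      have "- x\<^sup>2 / (2 * v) + q * x = q\<^sup>2 / 2 * v - (x - q * v)\<^sup>2 / (2 * v)"
        using 2(1) by (simp add: field_simps power2_eq_square)
      then have "exp (- x\<^sup>2 / (2 * v)) * exp (q * x) = exp (q\<^sup>2 / 2 * v) * exp (- (x - q * v)\<^sup>2 / (2 * v))"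
        by (simp add: exp_add[symmetric])
      then show ?thesis using 2(1) by (simp add: normal_density_def)
    qed
    have "(\<integral>\<^sup>+\<omega>. ennreal (exp (q * X \<omega>)) \<partial>M) = (\<integral>\<^sup>+x. ennreal (normal_density 0 (sqrt v) x) * ennreal (exp (q * x)) \<partial>lborel)"
      using distributed_nn_integral[OF 2(2), of "\<lambda>x. ennreal (exp (q * x))"] by simp
    also have "\<dots> = (\<integral>\<^sup>+x. ennreal (exp (q\<^sup>2 / 2 * v)) * ennreal (normal_density (q * v) (sqrt v) x) \<partial>lborel)"
      using ident by (simp add: ennreal_mult'[symmetric])
    also have "\<dots> = ennreal (exp (q\<^sup>2 / 2 * v)) * (\<integral>\<^sup>+x. ennreal (normal_density (q * v) (sqrt v) x) \<partial>lborel)"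
      by (intro nn_integral_cmult) auto
    also have "(\<integral>\<^sup>+x. ennreal (normal_density (q * v) (sqrt v) x) \<partial>lborel) = 1"
      using prob_space.emeasure_space_1[OF prob_space_normal_density[of "sqrt v" "q * v"]] 2(1)
      by (simp add: emeasure_density)
    finally show ?thesis by simp
  qed
qed

text \<open>
  One \<open>circle_energy_const\<close> comes from the circle of radius \<open>r\<close> and one from the unit circle; the
  logarithms come from the two mixed terms, since all points involved are at distance at most 4.\<close>

definition variance_const :: real where
  "variance_const = 2 * circle_energy_const + 2 * ln 4"

lemma circle_avg_measurable:
  assumes "normalized_whole_plane_GFF M h" "0 < r" "r \<le> 1"
  shows "circle_avg h r z \<in> borel_measurable M"
  using assms circle_measure_in_field_index[of r z]
  unfolding normalized_whole_plane_GFF_def whole_plane_GFF_def circle_avg_def by blast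

text \<open>
  The normalization makes the circle average equal to its difference with the average over the
  unit circle. This is a pairing with a signed measure of mass zero, so its law is prescribed and
  its variance is a combination of four energies.\<close>

lemma exp_moment_circle_avg:
  assumes M: "prob_space M" and h: "normalized_whole_plane_GFF M h"
    and r: "0 < r" "r \<le> 1" and z: "norm z \<le> 2"
  shows "(\<integral>\<^sup>+\<omega>. ennreal (exp (q * circle_avg h r z \<omega>)) \<partial>M)
    \<le> ennreal (exp (q\<^sup>2 / 2 * (- ln r + variance_const)))"
proof -
  interpret prob_space M by fact
  let ?\<mu> = "circle_measure z r" and ?\<nu> = "circle_measure 0 1"
  have norm: "AE \<omega> in M. h ?\<nu> \<omega> = 0"
    using h by (simp add: normalized_whole_plane_GFF_def circle_avg_def)
  have const: "0 \<le> - ln r" "0 \<le> variance_const"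
    using r circle_energy_const_nonneg by (auto simp: variance_const_def)
  \<comment> \<open>The signed measures are formal combinations over sets of measures, hence the two circles must be
    distinct for the coefficients to be well defined; this fails for the unit circle itself.\<close>
  show ?thesis
  proof (cases "?\<mu> = ?\<nu>")
    case True
    have "(\<integral>\<^sup>+\<omega>. ennreal (exp (q * circle_avg h r z \<omega>)) \<partial>M) = (\<integral>\<^sup>+\<omega>. 1 \<partial>M)"
      using norm by (intro nn_integral_cong_AE) (auto simp: circle_avg_def True)
    also have "\<dots> = ennreal 1" using emeasure_space_1 by simp
    also have "\<dots> \<le> ennreal (exp (q\<^sup>2 / 2 * (- ln r + variance_const)))"
      using const by (intro ennreal_leI) auto
    finally show ?thesis .
  next
    case False
    define a where "a = (\<lambda>\<rho>. if \<rho> = ?\<mu> then 1 else - 1 :: real)"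
    define v where "v = (\<Sum>\<rho>\<in>{?\<mu>, ?\<nu>}. \<Sum>\<rho>'\<in>{?\<mu>, ?\<nu>}. a \<rho> * a \<rho>' * log_energy \<rho> \<rho>')"
    have "measure ?\<mu> (space ?\<mu>) = 1" "measure ?\<nu> (space ?\<nu>) = 1"
      by (simp_all add: prob_space.prob_space[OF prob_space_circle_measure])
    then have "(\<Sum>\<rho>\<in>{?\<mu>, ?\<nu>}. a \<rho> * measure \<rho> (space \<rho>)) = 0"
      using False by (simp add: a_def)
    moreover have "{?\<mu>, ?\<nu>} \<subseteq> field_index" using circle_measure_in_field_index r by simp
    moreover have "finite I \<and> I \<subseteq> field_index \<and> (\<Sum>\<rho>\<in>I. b \<rho> * measure \<rho> (space \<rho>)) = 0 \<longrightarrow>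
        centered_gaussian M (\<lambda>\<omega>. \<Sum>\<rho>\<in>I. b \<rho> * h \<rho> \<omega>)
          (\<Sum>\<rho>\<in>I. \<Sum>\<rho>'\<in>I. b \<rho> * b \<rho>' * log_energy \<rho> \<rho>')" for I b
      using h unfolding normalized_whole_plane_GFF_def whole_plane_GFF_def by blast
    ultimately have "centered_gaussian M (\<lambda>\<omega>. \<Sum>\<rho>\<in>{?\<mu>, ?\<nu>}. a \<rho> * h \<rho> \<omega>) v"
      unfolding v_def by (simp only: finite_insert finite.emptyI simp_thms)
    then have gauss: "centered_gaussian M (\<lambda>\<omega>. h ?\<mu> \<omega> - h ?\<nu> \<omega>) v"
      using False by (simp add: a_def)
    have "v = log_energy ?\<mu> ?\<mu> - log_energy ?\<mu> ?\<nu> - log_energy ?\<nu> ?\<mu> + log_energy ?\<nu> ?\<nu>"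
      using False by (simp add: v_def a_def)
    also have "\<dots> \<le> - ln r + variance_const"
      using circle_log_energy_le[OF r, of z] circle_log_energy_le[of 1 0]
        circle_log_energy_ge[of 4 z 0 r 1] circle_log_energy_ge[of 4 0 z 1 r] r z
      by (simp add: variance_const_def)
    finally have v: "v \<le> - ln r + variance_const" .
    have "(\<integral>\<^sup>+\<omega>. ennreal (exp (q * circle_avg h r z \<omega>)) \<partial>M) =
       (\<integral>\<^sup>+\<omega>. ennreal (exp (q * (h ?\<mu> \<omega> - h ?\<nu> \<omega>))) \<partial>M)"
      using norm by (intro nn_integral_cong_AE) (auto simp: circle_avg_def)
    also have "\<dots> = ennreal (exp (q\<^sup>2 / 2 * v))"
      by (rule nn_integral_exp_centered_gaussian[OF gauss M])
    also have "\<dots> \<le> ennreal (exp (q\<^sup>2 / 2 * (- ln r + variance_const)))"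
      using v by (intro ennreal_leI) (simp add: mult_left_mono)
    finally show ?thesis .
  qed
qed

section \<open>Lattice paths and crossing distances\<close>

lemma lattice_square_eq:
  assumes "0 < \<epsilon>"
  shows "lattice_square \<epsilon> = (\<lambda>(m, n). Complex (\<epsilon> * of_int m) (\<epsilon> * of_int n)) ` ({0..\<lfloor>1 / \<epsilon>\<rfloor>} \<times> {0..\<lfloor>1 / \<epsilon>\<rfloor>})"
proof -
  have "0 \<le> \<epsilon> * of_int m \<and> \<epsilon> * of_int m \<le> 1 \<longleftrightarrow> m \<in> {0..\<lfloor>1 / \<epsilon>\<rfloor>}" for m :: int
    using assms by (auto simp: le_floor_iff field_simps zero_le_mult_iff)
  then show ?thesis unfolding lattice_square_def by fastforce
qed

lemma finite_lattice_square: "0 < \<epsilon> \<Longrightarrow> finite (lattice_square \<epsilon>)"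
  by (simp add: lattice_square_eq)

lemma card_lattice_square:
  assumes "0 < \<epsilon>" "\<epsilon> \<le> 1" shows "real (card (lattice_square \<epsilon>)) \<le> 4 * \<epsilon> powr - 2"
proof -
  have "card (lattice_square \<epsilon>) \<le> card ({0..\<lfloor>1 / \<epsilon>\<rfloor>} \<times> {0..\<lfloor>1 / \<epsilon>\<rfloor>})"
    unfolding lattice_square_eq[OF assms(1)] by (intro card_image_le) auto
  then have "real (card (lattice_square \<epsilon>)) \<le> real (nat (\<lfloor>1 / \<epsilon>\<rfloor> + 1) * nat (\<lfloor>1 / \<epsilon>\<rfloor> + 1))"
    by (simp add: card_cartesian_product del: of_nat_mult)
  also have "\<dots> = (of_int \<lfloor>1 / \<epsilon>\<rfloor> + 1)\<^sup>2"
    using assms by (simp add: power2_eq_square)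
  also have "\<dots> \<le> (2 / \<epsilon>)\<^sup>2"
  proof (rule power_mono)
    have "of_int \<lfloor>1 / \<epsilon>\<rfloor> \<le> 1 / \<epsilon>" "1 \<le> 1 / \<epsilon>" "2 / \<epsilon> = 1 / \<epsilon> + 1 / \<epsilon>" using assms by auto
    then show "of_int \<lfloor>1 / \<epsilon>\<rfloor> + 1 \<le> 2 / \<epsilon>" by linarith
    show "0 \<le> of_int \<lfloor>1 / \<epsilon>\<rfloor> + (1::real)" using assms by simp
  qed
  also have "\<dots> = 4 * \<epsilon> powr - 2"
    using assms by (simp add: powr_minus powr_numeral divide_inverse power_mult_distrib power_inverse)
  finally show ?thesis .
qed

lemma norm_lattice_square: "z \<in> lattice_square \<epsilon> \<Longrightarrow> norm z \<le> 2"
  using cmod_le[of z] by (auto simp: lattice_square_def)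

lemma lattice_path_0 [simp]: "lattice_path \<epsilon> 0 P \<longleftrightarrow> P 0 \<in> lattice_square \<epsilon>"
  by (auto simp: lattice_path_def)

lemma lattice_path_append:
  assumes P: "lattice_path \<epsilon> N P" and Q: "lattice_path \<epsilon> N' Q" and eq: "P N = Q 0"
  shows "lattice_path \<epsilon> (N + N') (\<lambda>j. if j \<le> N then P j else Q (j - N))"
proof -
  let ?R = "\<lambda>j. if j \<le> N then P j else Q (j - N)"
  have R: "?R j = Q (j - N)" if "N \<le> j" for j using that eq by auto
  have "dist (?R j) (?R (Suc j)) = \<epsilon>" if j: "j < N + N'" for j
  proof (cases "j < N")
    case True
    then show ?thesis using P by (simp add: lattice_path_def)
  next
    case False
    then show ?thesis using Q j unfolding lattice_path_def by (subst (1 2) R) (auto simp: Suc_diff_le)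
  qed
  moreover have "?R j \<in> lattice_square \<epsilon>" if "j \<le> N + N'" for j
    using P Q that by (auto simp: lattice_path_def)
  ultimately show ?thesis unfolding lattice_path_def by blast
qed

lemma lattice_path_rev: "lattice_path \<epsilon> N P \<Longrightarrow> lattice_path \<epsilon> N (\<lambda>j. P (N - j))"
  unfolding lattice_path_def by (auto simp: dist_commute) (metis Suc_diff_Suc diff_less_Suc dist_commute less_SucE not_less_eq diff_le_self le_eq_less_or_eq)

text \<open>
  Connectedness of the lattice square guarantees that the infima defining the distances are taken
  over nonempty sets, so that they carry information about actual paths.\<close>

definition joined :: "real \<Rightarrow> complex \<Rightarrow> complex \<Rightarrow> bool" where
  "joined \<epsilon> z w \<longleftrightarrow> (\<exists>N P. lattice_path \<epsilon> N P \<and> P 0 = z \<and> P N = w)"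

lemma joined_refl: "z \<in> lattice_square \<epsilon> \<Longrightarrow> joined \<epsilon> z z"
  unfolding joined_def by (intro exI[of _ 0] exI[of _ "\<lambda>_. z"]) simp

lemma joined_trans: "joined \<epsilon> z w \<Longrightarrow> joined \<epsilon> w x \<Longrightarrow> joined \<epsilon> z x"
  unfolding joined_def
proof (elim exE conjE)
  fix N P N' Q assume *: "lattice_path \<epsilon> N P" "P 0 = z" "P N = w" "lattice_path \<epsilon> N' Q" "Q 0 = w" "Q N' = x"
  show "\<exists>N P. lattice_path \<epsilon> N P \<and> P 0 = z \<and> P N = x"
    using lattice_path_append[OF *(1,4)] *
    by (intro exI[of _ "N + N'"] exI[of _ "\<lambda>j. if j \<le> N then P j else Q (j - N)"]) auto
qed

lemma joined_sym: "joined \<epsilon> z w \<Longrightarrow> joined \<epsilon> w z"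
  unfolding joined_def by (elim exE conjE, drule lattice_path_rev) (rule exI, rule exI, erule conjI, simp)

lemma joined_step: "z \<in> lattice_square \<epsilon> \<Longrightarrow> w \<in> lattice_square \<epsilon> \<Longrightarrow> dist z w = \<epsilon> \<Longrightarrow> joined \<epsilon> z w"
  unfolding joined_def
  by (intro exI[of _ 1] exI[of _ "\<lambda>j. if j = 0 then z else w"]) (auto simp: lattice_path_def)

lemma in_lattice_square:
  "0 < \<epsilon> \<Longrightarrow> Complex (\<epsilon> * real m) (\<epsilon> * real n) \<in> lattice_square \<epsilon> \<longleftrightarrow> \<epsilon> * real m \<le> 1 \<and> \<epsilon> * real n \<le> 1"
  unfolding lattice_square_def by (auto intro: exI[of _ "int m"] exI[of _ "int n"])

lemma lattice_squareE:
  assumes "0 < \<epsilon>" "z \<in> lattice_square \<epsilon>"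
  obtains m n :: nat where "z = Complex (\<epsilon> * real m) (\<epsilon> * real n)" "\<epsilon> * real m \<le> 1" "\<epsilon> * real n \<le> 1"
proof -
  from assms(2) obtain m n :: int where z: "z = Complex (\<epsilon> * of_int m) (\<epsilon> * of_int n)"
    "0 \<le> Re z" "Re z \<le> 1" "0 \<le> Im z" "Im z \<le> 1"
    unfolding lattice_square_def by blast
  with assms(1) have "0 \<le> m" "0 \<le> n" by (auto simp: zero_le_mult_iff)
  with z show ?thesis by (intro that[of "nat m" "nat n"]) auto
qed

lemma lattice_square_joined:
  assumes \<epsilon>: "0 < \<epsilon>" and z: "z \<in> lattice_square \<epsilon>" and w: "w \<in> lattice_square \<epsilon>"
  shows "joined \<epsilon> z w"
proof -
  have horizontal: "joined \<epsilon> (Complex (\<epsilon> * real m) (\<epsilon> * real n)) (Complex 0 (\<epsilon> * real n))"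
    if "\<epsilon> * real m \<le> 1" "\<epsilon> * real n \<le> 1" for m n
    using that
  proof (induction m)
    case 0
    then show ?case using in_lattice_square[OF \<epsilon>, of 0 n] by (auto intro: joined_refl)
  next
    case (Suc m)
    have le: "\<epsilon> * real m \<le> 1" using Suc.prems \<epsilon> by (simp add: distrib_left)
    have "joined \<epsilon> (Complex (\<epsilon> * real (Suc m)) (\<epsilon> * real n)) (Complex (\<epsilon> * real m) (\<epsilon> * real n))"
      using Suc.prems le \<epsilon> in_lattice_square[OF \<epsilon>, of m n] in_lattice_square[OF \<epsilon>, of "Suc m" n]
      by (intro joined_step) (auto simp: dist_norm complex_diff cmod_def distrib_left)
    then show ?case using Suc.IH[OF le] Suc.prems joined_trans by blast
  qed
  have vertical: "joined \<epsilon> (Complex 0 (\<epsilon> * real n)) (Complex 0 0)" if "\<epsilon> * real n \<le> 1" for n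
    using that
  proof (induction n)
    case 0
    then show ?case using in_lattice_square[OF \<epsilon>, of 0 0] by (auto intro: joined_refl)
  next
    case (Suc n)
    have le: "\<epsilon> * real n \<le> 1" using Suc.prems \<epsilon> by (simp add: distrib_left)
    have "joined \<epsilon> (Complex 0 (\<epsilon> * real (Suc n))) (Complex 0 (\<epsilon> * real n))"
      using Suc.prems le \<epsilon> in_lattice_square[OF \<epsilon>, of 0 n] in_lattice_square[OF \<epsilon>, of 0 "Suc n"]
      by (intro joined_step) (auto simp: dist_norm complex_diff cmod_def distrib_left)
    then show ?case using Suc.IH[OF le] joined_trans by blast
  qed
  have origin: "joined \<epsilon> x (Complex 0 0)" if x: "x \<in> lattice_square \<epsilon>" for x
    using lattice_squareE[OF \<epsilon> x] horizontal vertical joined_trans by metis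
  show ?thesis using origin[OF z] joined_sym[OF origin[OF w]] joined_trans by blast
qed

text \<open>
  Loop erasure: cutting out the part between two visits to the same vertex decreases every sum of
  nonnegative weights along the path. Along a path without repetitions such a sum is at most the
  sum over the whole lattice, which is how first moment bounds reach the paths.\<close>

lemma ex_simple_lattice_path:
  assumes "lattice_path \<epsilon> N P"
  obtains N' P' where "lattice_path \<epsilon> N' P'" "P' 0 = P 0" "P' N' = P N" "inj_on P' {0..N'}"
    "\<And>g :: complex \<Rightarrow> real. (\<And>z. 0 \<le> g z) \<Longrightarrow> (\<Sum>j = 0..N'. g (P' j)) \<le> (\<Sum>j = 0..N. g (P j))"
  using assms
proof (induction N arbitrary: P thesis rule: less_induct)
  case (less N)
  show thesis
  proof (cases "inj_on P {0..N}")
    case True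
    with less.prems show thesis by blast
  next
    case False
    then obtain i k where ik: "i < k" "k \<le> N" "P i = P k"
      unfolding inj_on_def by (metis atLeastAtMost_iff linorder_neqE_nat)
    \<comment> \<open>\<open>\<phi>\<close> enumerates the times that remain after the loop from time \<open>i\<close> to time \<open>k\<close> is removed\<close>
    define \<phi> where "\<phi> j = (if j \<le> i then j else j + (k - i))" for j
    define N1 where "N1 = N - (k - i)"
    have N1: "N1 < N" "i \<le> N1" using ik by (auto simp: N1_def)
    have path: "lattice_path \<epsilon> N1 (P \<circ> \<phi>)"
      unfolding lattice_path_def
    proof (intro conjI allI impI)
      fix j assume "j \<le> N1"
      then have "\<phi> j \<le> N" using ik by (auto simp: \<phi>_def N1_def)
      then show "(P \<circ> \<phi>) j \<in> lattice_square \<epsilon>" using less.prems(2) by (simp add: lattice_path_def)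
    next
      fix j assume j: "j < N1"
      then have "\<phi> j < N" using ik by (auto simp: \<phi>_def N1_def)
      have "j = i \<or> \<phi> (Suc j) = Suc (\<phi> j)" by (auto simp: \<phi>_def)
      moreover have "P (\<phi> (Suc i)) = P (Suc k)" "P (\<phi> i) = P k" using ik by (auto simp: \<phi>_def)
      moreover have "j = i \<Longrightarrow> k < N" using j ik by (auto simp: N1_def)
      ultimately show "dist ((P \<circ> \<phi>) j) ((P \<circ> \<phi>) (Suc j)) = \<epsilon>"
        using less.prems(2) \<open>\<phi> j < N\<close> unfolding lattice_path_def by (metis comp_apply)
    qed
    have "N1 = i \<and> N = k \<or> \<phi> N1 = N" using ik by (auto simp: \<phi>_def N1_def)
    then have ends: "(P \<circ> \<phi>) 0 = P 0" "(P \<circ> \<phi>) N1 = P N" using ik by (auto simp: \<phi>_def)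
    have le: "(\<Sum>j = 0..N1. g ((P \<circ> \<phi>) j)) \<le> (\<Sum>j = 0..N. g (P j))" if "\<And>z. 0 \<le> g z" for g :: "complex \<Rightarrow> real"
    proof -
      have "inj_on \<phi> {0..N1}" by (auto simp: \<phi>_def inj_on_def split: if_splits)
      then have "(\<Sum>j = 0..N1. g ((P \<circ> \<phi>) j)) = (\<Sum>j\<in>\<phi> ` {0..N1}. g (P j))"
        by (simp add: sum.reindex)
      also have "\<dots> \<le> (\<Sum>j = 0..N. g (P j))"
        using that ik by (intro sum_mono2) (auto simp: \<phi>_def N1_def)
      finally show ?thesis .
    qed
    show thesis
    proof (rule less.IH[OF N1(1) _ path])
      fix N' P'
      assume "lattice_path \<epsilon> N' P'" "P' 0 = (P \<circ> \<phi>) 0" "P' N' = (P \<circ> \<phi>) N1" "inj_on P' {0..N'}"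
        "\<And>g :: complex \<Rightarrow> real. (\<And>z. 0 \<le> g z) \<Longrightarrow> (\<Sum>j = 0..N'. g (P' j)) \<le> (\<Sum>j = 0..N1. g ((P \<circ> \<phi>) j))"
      then show thesis using less.prems(1)[of N' P'] ends le order_trans by metis
    qed
  qed
qed

lemma lfpp_length_nonneg: "0 \<le> \<epsilon> \<Longrightarrow> 0 \<le> lfpp_length f \<xi> \<epsilon> N P"
  by (auto simp: lfpp_length_def intro!: sum_nonneg)

lemma lfpp_dist_le:
  assumes "0 < \<epsilon>" "lattice_path \<epsilon> N P"
  shows "lfpp_dist f \<xi> \<epsilon> (P 0) (P N) \<le> lfpp_length f \<xi> \<epsilon> N P"
  unfolding lfpp_dist_def
  using assms by (intro cInf_lower bdd_belowI[of _ 0]) (auto intro: lfpp_length_nonneg)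

lemma lfpp_dist_nonneg:
  assumes "0 < \<epsilon>" "z \<in> lattice_square \<epsilon>" "w \<in> lattice_square \<epsilon>"
  shows "0 \<le> lfpp_dist f \<xi> \<epsilon> z w"
  unfolding lfpp_dist_def
  using lattice_square_joined[OF assms] assms(1)
  by (intro cInf_greatest) (auto simp: joined_def intro: lfpp_length_nonneg)

lemma lfpp_set_dist_le:
  assumes \<epsilon>: "0 < \<epsilon>" and A: "A \<subseteq> lattice_square \<epsilon>" and B: "B \<subseteq> lattice_square \<epsilon>"
    and P: "lattice_path \<epsilon> N P" "P 0 \<in> A" "P N \<in> B"
  shows "lfpp_set_dist f \<xi> \<epsilon> A B \<le> lfpp_length f \<xi> \<epsilon> N P"
proof -
  have "lfpp_set_dist f \<xi> \<epsilon> A B \<le> lfpp_dist f \<xi> \<epsilon> (P 0) (P N)"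
    unfolding lfpp_set_dist_def
    using A B P by (intro cInf_lower bdd_belowI[of _ 0]) (auto intro!: lfpp_dist_nonneg[OF \<epsilon>])
  then show ?thesis using lfpp_dist_le[OF \<epsilon> P(1)] by (rule order_trans)
qed

lemma lfpp_set_dist_lessE:
  assumes \<epsilon>: "0 < \<epsilon>" and A: "A \<subseteq> lattice_square \<epsilon>" "A \<noteq> {}" and B: "B \<subseteq> lattice_square \<epsilon>" "B \<noteq> {}"
    and less: "lfpp_set_dist f \<xi> \<epsilon> A B < x"
  obtains N P where "lattice_path \<epsilon> N P" "P 0 \<in> A" "P N \<in> B" "lfpp_length f \<xi> \<epsilon> N P < x"
proof -
  have "\<exists>y\<in>{lfpp_dist f \<xi> \<epsilon> z w | z w. z \<in> A \<and> w \<in> B}. y < x"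
    using less A B unfolding lfpp_set_dist_def by (intro cInf_lessD) auto
  then obtain z w where zw: "z \<in> A" "w \<in> B" "lfpp_dist f \<xi> \<epsilon> z w < x" by auto
  have "\<exists>y\<in>{lfpp_length f \<xi> \<epsilon> N P | N P. lattice_path \<epsilon> N P \<and> P 0 = z \<and> P N = w}. y < x"
    using zw lattice_square_joined[OF \<epsilon>, of z w] A B unfolding lfpp_dist_def
    by (intro cInf_lessD) (auto simp: joined_def)
  then show ?thesis using that zw by auto
qed

lemma boundary_subset: "left_boundary \<epsilon> \<subseteq> lattice_square \<epsilon>" "right_boundary \<epsilon> \<subseteq> lattice_square \<epsilon>"
  by (auto simp: left_boundary_def right_boundary_def)

lemma left_boundary_Re_less:
  assumes "0 < \<epsilon>" "z \<in> left_boundary \<epsilon>" shows "Re z < \<epsilon>"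
proof (rule ccontr)
  assume *: "\<not> Re z < \<epsilon>"
  obtain m n :: nat where z: "z = Complex (\<epsilon> * real m) (\<epsilon> * real n)" "\<epsilon> * real m \<le> 1" "\<epsilon> * real n \<le> 1"
    using lattice_squareE assms unfolding left_boundary_def by blast
  with * assms have "m \<ge> 1" by (cases m) auto
  then have "z - of_real \<epsilon> = Complex (\<epsilon> * real (m - 1)) (\<epsilon> * real n)"
    using z by (simp add: complex_eq_iff of_nat_diff algebra_simps)
  moreover have "\<epsilon> * real (m - 1) \<le> 1" using z \<open>m \<ge> 1\<close> assms by (simp add: of_nat_diff algebra_simps)
  ultimately have "z - of_real \<epsilon> \<in> lattice_square \<epsilon>"
    using in_lattice_square[OF assms(1)] z by simp
  then show False using assms by (simp add: left_boundary_def)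
qed

lemma right_boundary_Re_greater:
  assumes "0 < \<epsilon>" "z \<in> right_boundary \<epsilon>" shows "1 - \<epsilon> < Re z"
proof (rule ccontr)
  assume *: "\<not> 1 - \<epsilon> < Re z"
  obtain m n :: nat where z: "z = Complex (\<epsilon> * real m) (\<epsilon> * real n)" "\<epsilon> * real m \<le> 1" "\<epsilon> * real n \<le> 1"
    using lattice_squareE assms unfolding right_boundary_def by blast
  have "z + of_real \<epsilon> = Complex (\<epsilon> * real (Suc m)) (\<epsilon> * real n)"
    using z by (simp add: complex_eq_iff algebra_simps)
  moreover have "\<epsilon> * real (Suc m) \<le> 1" using z * by (simp add: algebra_simps)
  ultimately have "z + of_real \<epsilon> \<in> lattice_square \<epsilon>"
    using in_lattice_square[OF assms(1), of "Suc m" n] z by simp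
  then show False using assms by (simp add: right_boundary_def)
qed

definition row_length :: "real \<Rightarrow> nat" where "row_length \<epsilon> = nat \<lfloor>1 / \<epsilon>\<rfloor>"

definition row_path :: "real \<Rightarrow> nat \<Rightarrow> complex" where "row_path \<epsilon> j = Complex (\<epsilon> * real j) 0"

lemma row_length_bounds:
  assumes "0 < \<epsilon>" shows "\<epsilon> * real (row_length \<epsilon>) \<le> 1" "1 < \<epsilon> * real (Suc (row_length \<epsilon>))"
proof -
  have "real (row_length \<epsilon>) = of_int \<lfloor>1 / \<epsilon>\<rfloor>" using assms by (simp add: row_length_def)
  then have "real (row_length \<epsilon>) \<le> 1 / \<epsilon>" "1 / \<epsilon> < real (row_length \<epsilon>) + 1"
    using floor_correct[of "1 / \<epsilon>"] by auto
  then show "\<epsilon> * real (row_length \<epsilon>) \<le> 1" "1 < \<epsilon> * real (Suc (row_length \<epsilon>))"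
    using assms by (auto simp: field_simps)
qed

lemma row_path:
  assumes \<epsilon>: "0 < \<epsilon>"
  shows "lattice_path \<epsilon> (row_length \<epsilon>) (row_path \<epsilon>)" "row_path \<epsilon> 0 \<in> left_boundary \<epsilon>"
    "row_path \<epsilon> (row_length \<epsilon>) \<in> right_boundary \<epsilon>"
proof -
  have in_sq: "row_path \<epsilon> j \<in> lattice_square \<epsilon> \<longleftrightarrow> \<epsilon> * real j \<le> 1" for j
    using in_lattice_square[OF \<epsilon>, of j 0] by (simp add: row_path_def)
  have le: "\<epsilon> * real j \<le> 1" if "j \<le> row_length \<epsilon>" for j
    using that row_length_bounds(1)[OF \<epsilon>] \<epsilon> by (meson mult_le_cancel_left_pos of_nat_mono order_trans)
  show "lattice_path \<epsilon> (row_length \<epsilon>) (row_path \<epsilon>)"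
    using \<epsilon> le unfolding lattice_path_def in_sq
    by (auto simp: row_path_def dist_norm complex_diff cmod_def distrib_left)
  show "row_path \<epsilon> 0 \<in> left_boundary \<epsilon>"
    using in_sq[of 0] \<epsilon> unfolding left_boundary_def by (auto simp: lattice_square_def row_path_def)
  have "row_path \<epsilon> (row_length \<epsilon>) + of_real \<epsilon> = row_path \<epsilon> (Suc (row_length \<epsilon>))"
    by (simp add: row_path_def complex_eq_iff distrib_left)
  then show "row_path \<epsilon> (row_length \<epsilon>) \<in> right_boundary \<epsilon>"
    using in_sq[of "row_length \<epsilon>"] in_sq[of "Suc (row_length \<epsilon>)"] row_length_bounds[OF \<epsilon>]
    unfolding right_boundary_def by simp
qed

lemma inj_row_path: "0 < \<epsilon> \<Longrightarrow> inj (row_path \<epsilon>)"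
  by (auto simp: inj_def row_path_def)

text \<open>
  Each step moves the real part by at most \<open>\<epsilon>\<close>, and both boundaries are within \<open>\<epsilon>\<close> of the sides of
  the square.\<close>

lemma crossing_path_steps:
  assumes \<epsilon>: "0 < \<epsilon>" and P: "lattice_path \<epsilon> N P" "P 0 \<in> left_boundary \<epsilon>" "P N \<in> right_boundary \<epsilon>"
  shows "1 - \<epsilon> \<le> \<epsilon> * (real N + 1)"
proof -
  have "Re (P j) \<le> Re (P 0) + real j * \<epsilon>" if "j \<le> N" for j
    using that
  proof (induction j)
    case (Suc j)
    have "dist (P j) (P (Suc j)) = \<epsilon>" using P(1) Suc.prems by (simp add: lattice_path_def)
    then have "Re (P (Suc j)) - Re (P j) \<le> \<epsilon>"
      using abs_Re_le_cmod[of "P (Suc j) - P j"] by (simp add: dist_norm norm_minus_commute)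
    then show ?case using Suc by (simp add: algebra_simps)
  qed simp
  from this[of N] left_boundary_Re_less[OF \<epsilon> P(2)] right_boundary_Re_greater[OF \<epsilon> P(3)]
  show ?thesis by (simp add: algebra_simps)
qed

abbreviation crossing_dist :: "(complex \<Rightarrow> real) \<Rightarrow> real \<Rightarrow> real \<Rightarrow> real" where
  "crossing_dist f \<xi> \<epsilon> \<equiv> lfpp_set_dist f \<xi> \<epsilon> (left_boundary \<epsilon>) (right_boundary \<epsilon>)"

lemma crossing_dist_le:
  assumes "0 < \<epsilon>" "lattice_path \<epsilon> N P" "P 0 \<in> left_boundary \<epsilon>" "P N \<in> right_boundary \<epsilon>"
  shows "crossing_dist f \<xi> \<epsilon> \<le> lfpp_length f \<xi> \<epsilon> N P"
  using assms boundary_subset by (intro lfpp_set_dist_le) auto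

lemma crossing_dist_lessE:
  assumes \<epsilon>: "0 < \<epsilon>" and "crossing_dist f \<xi> \<epsilon> < x"
  obtains N P where "lattice_path \<epsilon> N P" "P 0 \<in> left_boundary \<epsilon>" "P N \<in> right_boundary \<epsilon>"
    "inj_on P {0..N}" "lfpp_length f \<xi> \<epsilon> N P < x"
proof -
  obtain N P where P: "lattice_path \<epsilon> N P" "P 0 \<in> left_boundary \<epsilon>" "P N \<in> right_boundary \<epsilon>"
    "lfpp_length f \<xi> \<epsilon> N P < x"
    using lfpp_set_dist_lessE[OF \<epsilon> boundary_subset(1) _ boundary_subset(2) _ assms(2)] row_path[OF \<epsilon>] by blast
  obtain N' P' where P': "lattice_path \<epsilon> N' P'" "P' 0 = P 0" "P' N' = P N" "inj_on P' {0..N'}"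
    and le: "\<And>g :: complex \<Rightarrow> real. (\<And>z. 0 \<le> g z) \<Longrightarrow> (\<Sum>j = 0..N'. g (P' j)) \<le> (\<Sum>j = 0..N. g (P j))"
    using ex_simple_lattice_path[OF P(1)] by blast
  have "lfpp_length f \<xi> \<epsilon> N' P' \<le> lfpp_length f \<xi> \<epsilon> N P"
    unfolding lfpp_length_def using \<epsilon> by (intro le) simp
  with P P' show ?thesis by (intro that[of N' P']) auto
qed

lemma crossing_dist_0_ge: "0 < \<epsilon> \<Longrightarrow> 1 - \<epsilon> \<le> crossing_dist f 0 \<epsilon>"
proof (rule ccontr)
  assume \<epsilon>: "0 < \<epsilon>" and "\<not> 1 - \<epsilon> \<le> crossing_dist f 0 \<epsilon>"
  then have "crossing_dist f 0 \<epsilon> < 1 - \<epsilon>" by simp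
  then obtain N P where P: "lattice_path \<epsilon> N P" "P 0 \<in> left_boundary \<epsilon>" "P N \<in> right_boundary \<epsilon>"
    "lfpp_length f 0 \<epsilon> N P < 1 - \<epsilon>" using crossing_dist_lessE[OF \<epsilon>] by metis
  then show False using crossing_path_steps[OF \<epsilon> P(1-3)] by (simp add: lfpp_length_def algebra_simps)
qed

lemma lfpp_length_cong: "(\<And>j. j \<le> N \<Longrightarrow> P j = Q j) \<Longrightarrow> lfpp_length f \<xi> \<epsilon> N P = lfpp_length f \<xi> \<epsilon> N Q"
  unfolding lfpp_length_def by (intro sum.cong) auto

text \<open>
  The length depends on a path only through its values on \<open>{0..N}\<close>; after restricting paths to this
  range only countably many are left, so the distance is a countable infimum.\<close>

lemma crossing_dist_measurable:
  assumes \<epsilon>: "0 < \<epsilon>" and f: "\<And>z. z \<in> lattice_square \<epsilon> \<Longrightarrow> (\<lambda>\<omega>. f \<omega> z) \<in> borel_measurable M"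
  shows "(\<lambda>\<omega>. crossing_dist (f \<omega>) \<xi> \<epsilon>) \<in> borel_measurable M"
proof -
  define paths where "paths z w = (SIGMA N:UNIV. {P \<in> {0..N} \<rightarrow>\<^sub>E lattice_square \<epsilon>. lattice_path \<epsilon> N P \<and> P 0 = z \<and> P N = w})" for z w
  have countable: "countable (paths z w)" for z w
  proof -
    have "countable ({0..N} \<rightarrow>\<^sub>E lattice_square \<epsilon>)" for N :: nat
      using finite_lattice_square[OF \<epsilon>] by (intro countable_PiE) (auto intro: countable_finite)
    then show ?thesis unfolding paths_def by (intro countable_SIGMA countable_Collect) auto
  qed
  have dist_eq: "lfpp_dist g \<xi> \<epsilon> z w = (INF (N, P)\<in>paths z w. lfpp_length g \<xi> \<epsilon> N P)" for g z w
  proof -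
    have "{lfpp_length g \<xi> \<epsilon> N P | N P. lattice_path \<epsilon> N P \<and> P 0 = z \<and> P N = w}
        = (\<lambda>(N, P). lfpp_length g \<xi> \<epsilon> N P) ` paths z w" (is "?L = ?R")
    proof
      show "?R \<subseteq> ?L" by (auto simp: paths_def)
      show "?L \<subseteq> ?R"
      proof
        fix x assume "x \<in> ?L"
        then obtain N P where P: "x = lfpp_length g \<xi> \<epsilon> N P" "lattice_path \<epsilon> N P" "P 0 = z" "P N = w" by blast
        then have "(N, restrict P {0..N}) \<in> paths z w"
          by (auto simp: paths_def lattice_path_def)
        moreover have "x = lfpp_length g \<xi> \<epsilon> N (restrict P {0..N})"
          unfolding P(1) by (intro lfpp_length_cong) auto
        ultimately show "x \<in> ?R" by (force intro: image_eqI[of _ _ "(N, restrict P {0..N})"])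
      qed
    qed
    then show ?thesis by (simp add: lfpp_dist_def)
  qed
  have len: "(\<lambda>\<omega>. case p of (N, P) \<Rightarrow> lfpp_length (f \<omega>) \<xi> \<epsilon> N P) \<in> borel_measurable M"
    if "p \<in> paths z w" for p z w
  proof -
    obtain N P where p: "p = (N, P)" by (cases p)
    then have "(\<lambda>\<omega>. f \<omega> (P j)) \<in> borel_measurable M" if "j \<in> {0..N}" for j
      using that \<open>p \<in> paths z w\<close> by (intro f) (auto simp: paths_def lattice_path_def)
    then have "(\<lambda>\<omega>. \<Sum>j = 0..N. \<epsilon> * exp (\<xi> * f \<omega> (P j))) \<in> borel_measurable M"
      by (intro borel_measurable_sum) measurable
    then show ?thesis by (simp add: p lfpp_length_def)
  qed
  have d: "(\<lambda>\<omega>. lfpp_dist (f \<omega>) \<xi> \<epsilon> z w) \<in> borel_measurable M" for z w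
    unfolding dist_eq using countable len by (intro borel_measurable_cINF_real)
  have "crossing_dist g \<xi> \<epsilon> = (INF (z, w)\<in>left_boundary \<epsilon> \<times> right_boundary \<epsilon>. lfpp_dist g \<xi> \<epsilon> z w)" for g
    unfolding lfpp_set_dist_def by (intro arg_cong[of _ _ Inf]) auto
  moreover have "countable (left_boundary \<epsilon> \<times> right_boundary \<epsilon>)"
    using finite_lattice_square[OF \<epsilon>] boundary_subset
    by (intro countable_finite finite_cartesian_product) (metis finite_subset)+
  ultimately show ?thesis
    using d by (simp add: case_prod_unfold)
qed

section \<open>Events of high probability\<close>

lemma sum_powr_le_powr_sum:
  fixes a :: "'i \<Rightarrow> real"
  assumes r: "1 \<le> r" and S: "finite S" and a: "\<And>i. i \<in> S \<Longrightarrow> 0 < a i"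
  shows "(\<Sum>i\<in>S. a i powr r) \<le> (\<Sum>i\<in>S. a i) powr r"
proof (cases "S = {}")
  case False
  let ?s = "\<Sum>i\<in>S. a i"
  have s: "0 < ?s" using S False a by (simp add: sum_pos)
  have "(\<Sum>i\<in>S. a i powr r) \<le> (\<Sum>i\<in>S. a i * ?s powr (r - 1))"
  proof (rule sum_mono)
    fix i assume i: "i \<in> S"
    have "a i \<le> ?s" using S i a by (intro member_le_sum) (auto intro: less_imp_le)
    then have "a i powr (r - 1) \<le> ?s powr (r - 1)" using a[OF i] r by (intro powr_mono2) auto
    then show "a i powr r \<le> a i * ?s powr (r - 1)" using a[OF i] by (simp add: powr_diff field_simps)
  qed
  also have "\<dots> = ?s * ?s powr (r - 1)" by (rule sum_distrib_right[symmetric])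
  also have "\<dots> = ?s powr r" using s by (simp add: powr_diff)
  finally show ?thesis .
qed simp

text \<open>
  The value \<open>\<theta> * ln \<epsilon>\<close> is a threshold for \<open>x\<close>. On one side of it, changing the parameter from
  \<open>\<xi>\<^sub>1\<close> to \<open>\<xi>\<^sub>2\<close> costs at most the first prefactor; on the other side the second term dominates. The
  sign condition says that the two sides cover everything: for \<open>\<xi>\<^sub>1 > \<xi>\<^sub>2\<close> the low values of \<open>x\<close>
  are exceptional, for \<open>\<xi>\<^sub>1 < \<xi>\<^sub>2\<close> the high ones.\<close>

lemma exp_le_threshold:
  fixes \<epsilon> x \<xi>\<^sub>1 \<xi>\<^sub>2 \<theta> :: real
  assumes "0 < \<epsilon>" and sgn: "0 \<le> (\<xi>\<^sub>2 + \<theta>) * (\<xi>\<^sub>1 - \<xi>\<^sub>2)"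
  shows "exp (\<xi>\<^sub>2 * x) \<le> \<epsilon> powr (- (\<xi>\<^sub>1 - \<xi>\<^sub>2) * \<theta>) * exp (\<xi>\<^sub>1 * x) + \<epsilon> powr ((\<xi>\<^sub>2 + \<theta>) * \<theta>) * exp (- \<theta> * x)"
proof -
  define y where "y = x - \<theta> * ln \<epsilon>"
  have 1: "\<epsilon> powr (- (\<xi>\<^sub>1 - \<xi>\<^sub>2) * \<theta>) * exp (\<xi>\<^sub>1 * x) = exp (\<xi>\<^sub>2 * x + (\<xi>\<^sub>1 - \<xi>\<^sub>2) * y)"
    and 2: "\<epsilon> powr ((\<xi>\<^sub>2 + \<theta>) * \<theta>) * exp (- \<theta> * x) = exp (\<xi>\<^sub>2 * x - (\<xi>\<^sub>2 + \<theta>) * y)"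
    using assms by (simp_all add: y_def powr_def exp_add[symmetric] algebra_simps)
  have "0 \<le> (\<xi>\<^sub>1 - \<xi>\<^sub>2) * y \<or> (\<xi>\<^sub>2 + \<theta>) * y \<le> 0"
    using sgn by (auto simp: zero_le_mult_iff mult_le_0_iff)
  then show ?thesis
  proof
    assume "0 \<le> (\<xi>\<^sub>1 - \<xi>\<^sub>2) * y"
    then have "exp (\<xi>\<^sub>2 * x) \<le> exp (\<xi>\<^sub>2 * x + (\<xi>\<^sub>1 - \<xi>\<^sub>2) * y)" by simp
    then show ?thesis unfolding 1 2 by (meson add_increasing2 exp_ge_zero)
  next
    assume "(\<xi>\<^sub>2 + \<theta>) * y \<le> 0"
    then have "exp (\<xi>\<^sub>2 * x) \<le> exp (\<xi>\<^sub>2 * x - (\<xi>\<^sub>2 + \<theta>) * y)" by simp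
    then show ?thesis unfolding 1 2 by (meson add_increasing exp_ge_zero)
  qed
qed

lemma powr_at_right_0: "0 < (a::real) \<Longrightarrow> ((\<lambda>\<epsilon>. \<epsilon> powr a) \<longlongrightarrow> 0) (at_right 0)"
  using tendsto_powr2[of "\<lambda>\<epsilon>. \<epsilon>" 0 "at_right 0" "\<lambda>_. a" a]
  by (simp add: eventually_at_right_less eventually_mono[OF eventually_at_right_less])

locale normalized_GFF = prob_space M for M :: "'w measure" +
  fixes h :: "complex measure \<Rightarrow> 'w \<Rightarrow> real"
  assumes GFF: "normalized_whole_plane_GFF M h"
begin

definition field :: "real \<Rightarrow> 'w \<Rightarrow> complex \<Rightarrow> real" where
  "field \<epsilon> \<omega> z = circle_avg h \<epsilon> z \<omega>"

lemma field_measurable [measurable]: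
  "0 < \<epsilon> \<Longrightarrow> \<epsilon> \<le> 1 \<Longrightarrow> (\<lambda>\<omega>. field \<epsilon> \<omega> z) \<in> borel_measurable M"
  unfolding field_def using circle_avg_measurable[OF GFF] by simp

text \<open>
  Measurability is part of the notion because the measure of a nonmeasurable set is zero by
  convention. It is required for scales up to 1, the range of the estimates on circle averages.\<close>

definition whp :: "(real \<Rightarrow> 'w set) \<Rightarrow> bool" where
  "whp E \<longleftrightarrow> (\<forall>\<epsilon>. 0 < \<epsilon> \<and> \<epsilon> \<le> 1 \<longrightarrow> E \<epsilon> \<in> events) \<and> ((\<lambda>\<epsilon>. prob (E \<epsilon>)) \<longlongrightarrow> 1) (at_right 0)"

lemma eventually_scale: "\<forall>\<^sub>F \<epsilon> :: real in at_right 0. 0 < \<epsilon> \<and> \<epsilon> \<le> 1"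
  by (auto simp: eventually_at_right_field intro: exI[of _ 1])

lemma whp_mono:
  assumes E: "whp E" and F: "\<And>\<epsilon>. 0 < \<epsilon> \<Longrightarrow> \<epsilon> \<le> 1 \<Longrightarrow> F \<epsilon> \<in> events"
    and sub: "\<forall>\<^sub>F \<epsilon> in at_right 0. E \<epsilon> \<subseteq> F \<epsilon>"
  shows "whp F"
proof -
  have "((\<lambda>\<epsilon>. prob (F \<epsilon>)) \<longlongrightarrow> 1) (at_right 0)"
  proof (rule tendsto_sandwich)
    show "\<forall>\<^sub>F \<epsilon> in at_right 0. prob (E \<epsilon>) \<le> prob (F \<epsilon>)"
      using sub eventually_scale by eventually_elim (auto intro!: finite_measure_mono F)
    show "((\<lambda>\<epsilon>. prob (E \<epsilon>)) \<longlongrightarrow> 1) (at_right 0)" using E by (simp add: whp_def)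
  qed auto
  then show ?thesis using F by (simp add: whp_def)
qed

lemma whp_Int:
  assumes E: "whp E" and F: "whp F" shows "whp (\<lambda>\<epsilon>. E \<epsilon> \<inter> F \<epsilon>)"
proof -
  have "((\<lambda>\<epsilon>. prob (E \<epsilon> \<inter> F \<epsilon>)) \<longlongrightarrow> 1) (at_right 0)"
  proof (rule tendsto_sandwich)
    show "\<forall>\<^sub>F \<epsilon> in at_right 0. prob (E \<epsilon>) + prob (F \<epsilon>) - 1 \<le> prob (E \<epsilon> \<inter> F \<epsilon>)"
      using eventually_scale
    proof eventually_elim
      case (elim \<epsilon>)
      then have "E \<epsilon> \<in> events" "F \<epsilon> \<in> events" using E F by (auto simp: whp_def)
      from finite_measure_Union'[OF this] finite_measure_Diff'[OF \<open>F \<epsilon> \<in> events\<close> \<open>E \<epsilon> \<in> events\<close>]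
        prob_le_1[of "E \<epsilon> \<union> F \<epsilon>"]
      show ?case by (simp add: Int_commute)
    qed
    have "((\<lambda>\<epsilon>. prob (E \<epsilon>) + prob (F \<epsilon>) - 1) \<longlongrightarrow> 1 + 1 - 1) (at_right 0)"
      using E F by (intro tendsto_intros) (auto simp: whp_def)
    then show "((\<lambda>\<epsilon>. prob (E \<epsilon>) + prob (F \<epsilon>) - 1) \<longlongrightarrow> 1) (at_right 0)" by simp
  qed auto
  then show ?thesis using E F by (auto simp: whp_def)
qed

text \<open>
  The expectation of the sum is at most of order \<open>\<epsilon>\<^bsup>- k - q\<^sup>2/2\<^esup>\<close>, as each of the \<open>\<epsilon>\<^bsup>- k\<^esup>\<close> terms has mean at most of order
  \<open>\<epsilon>\<^bsup>- q\<^sup>2/2\<^esup>\<close>; the Markov inequality gives the rest.\<close>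

lemma whp_exp_moment_sum:
  assumes S: "\<And>\<epsilon>. 0 < \<epsilon> \<Longrightarrow> \<epsilon> \<le> 1 \<Longrightarrow> S \<epsilon> \<subseteq> lattice_square \<epsilon>"
    and card: "\<And>\<epsilon>. 0 < \<epsilon> \<Longrightarrow> \<epsilon> \<le> 1 \<Longrightarrow> real (card (S \<epsilon>)) \<le> C * \<epsilon> powr - k"
    and a: "a < - k - q\<^sup>2 / 2"
  shows "whp (\<lambda>\<epsilon>. {\<omega> \<in> space M. (\<Sum>z\<in>S \<epsilon>. exp (q * field \<epsilon> \<omega> z)) \<le> \<epsilon> powr a})"
proof -
  define E where "E \<epsilon> = {\<omega> \<in> space M. (\<Sum>z\<in>S \<epsilon>. exp (q * field \<epsilon> \<omega> z)) \<le> \<epsilon> powr a}" for \<epsilon>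
  have E: "E \<epsilon> \<in> events" if "0 < \<epsilon>" "\<epsilon> \<le> 1" for \<epsilon>
    unfolding E_def using that by measurable
  have bound: "1 - prob (E \<epsilon>) \<le> C * exp (q\<^sup>2 / 2 * variance_const) * \<epsilon> powr (- a - k - q\<^sup>2 / 2)"
    if \<epsilon>: "0 < \<epsilon>" "\<epsilon> \<le> 1" for \<epsilon>
  proof -
    let ?X = "\<lambda>\<omega>. \<Sum>z\<in>S \<epsilon>. exp (q * field \<epsilon> \<omega> z)"
    let ?m = "exp (q\<^sup>2 / 2 * (- ln \<epsilon> + variance_const))"
    have fin: "finite (S \<epsilon>)" using S[OF \<epsilon>] finite_lattice_square[OF \<epsilon>(1)] by (rule finite_subset)
    have [measurable]: "?X \<in> borel_measurable M" using \<epsilon> by measurable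
    have "(\<integral>\<^sup>+\<omega>. ennreal (?X \<omega>) \<partial>M) = (\<Sum>z\<in>S \<epsilon>. \<integral>\<^sup>+\<omega>. ennreal (exp (q * field \<epsilon> \<omega> z)) \<partial>M)"
      using \<epsilon> by (simp add: sum_ennreal[symmetric] nn_integral_sum del: sum_ennreal)
    also have "\<dots> \<le> (\<Sum>z\<in>S \<epsilon>. ennreal ?m)"
      unfolding field_def using S[OF \<epsilon>] norm_lattice_square
      by (intro sum_mono exp_moment_circle_avg[OF prob_space_axioms GFF \<epsilon>]) auto
    also have "\<dots> = ennreal (real (card (S \<epsilon>)) * ?m)"
      by (simp add: ennreal_of_nat_eq_real_of_nat ennreal_mult'')
    also have "\<dots> \<le> ennreal (C * \<epsilon> powr - k * ?m)"
      using card[OF \<epsilon>] by (intro ennreal_leI mult_right_mono) auto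
    finally have mean: "(\<integral>\<^sup>+\<omega>. ennreal (?X \<omega>) \<partial>M) \<le> ennreal (C * \<epsilon> powr - k * ?m)" .
    have Ck: "0 \<le> C * \<epsilon> powr - k" using card[OF \<epsilon>] by (rule order_trans[rotated]) simp
    have "emeasure M (space M - E \<epsilon>) \<le> emeasure M {\<omega>\<in>space M. 1 \<le> ennreal (\<epsilon> powr - a) * ennreal (?X \<omega>)}"
    proof (intro emeasure_mono subsetI)
      fix \<omega> assume "\<omega> \<in> space M - E \<epsilon>"
      then have *: "\<omega> \<in> space M" "\<epsilon> powr a < ?X \<omega>" by (auto simp: E_def)
      have "1 = \<epsilon> powr - a * \<epsilon> powr a" using \<epsilon> by (simp add: powr_add[symmetric])
      also have "\<dots> \<le> \<epsilon> powr - a * ?X \<omega>" using * by (intro mult_left_mono) auto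
      finally have "ennreal 1 \<le> ennreal (\<epsilon> powr - a * ?X \<omega>)" by (rule ennreal_leI)
      then show "\<omega> \<in> {\<omega>\<in>space M. 1 \<le> ennreal (\<epsilon> powr - a) * ennreal (?X \<omega>)}"
        using * by (simp add: ennreal_mult')
    qed measurable
    also have "\<dots> \<le> ennreal (\<epsilon> powr - a) * (\<integral>\<^sup>+\<omega>. ennreal (?X \<omega>) * indicator (space M) \<omega> \<partial>M)"
      by (rule nn_integral_Markov_inequality) auto
    also have "(\<integral>\<^sup>+\<omega>. ennreal (?X \<omega>) * indicator (space M) \<omega> \<partial>M) = (\<integral>\<^sup>+\<omega>. ennreal (?X \<omega>) \<partial>M)"
      by (intro nn_integral_cong) auto
    also have "ennreal (\<epsilon> powr - a) * \<dots> \<le> ennreal (\<epsilon> powr - a) * ennreal (C * \<epsilon> powr - k * ?m)"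
      using mean by (intro mult_left_mono) auto
    also have "\<dots> = ennreal (\<epsilon> powr - a * (C * \<epsilon> powr - k * ?m))" by (simp add: ennreal_mult')
    finally have "prob (space M - E \<epsilon>) \<le> \<epsilon> powr - a * (C * \<epsilon> powr - k * ?m)"
      using Ck by (simp add: emeasure_eq_measure)
    moreover have "?m = exp (q\<^sup>2 / 2 * variance_const) * \<epsilon> powr - (q\<^sup>2 / 2)"
    proof -
      have "q\<^sup>2 / 2 * (- ln \<epsilon> + variance_const) = q\<^sup>2 / 2 * variance_const + - (q\<^sup>2 / 2) * ln \<epsilon>"
        by (simp add: right_diff_distrib)
      then show ?thesis using \<epsilon> by (simp only: exp_add) (simp add: powr_def)
    qed
    moreover have "\<epsilon> powr (- a - k - q\<^sup>2 / 2) = \<epsilon> powr - a * \<epsilon> powr - k * \<epsilon> powr - (q\<^sup>2 / 2)"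
      by (simp add: powr_add[symmetric])
    ultimately show ?thesis using prob_compl[OF E[OF \<epsilon>]] by (simp add: mult_ac)
  qed
  have "((\<lambda>\<epsilon>. prob (E \<epsilon>)) \<longlongrightarrow> 1) (at_right 0)"
  proof (rule tendsto_sandwich)
    show "\<forall>\<^sub>F \<epsilon> in at_right 0. 1 - C * exp (q\<^sup>2 / 2 * variance_const) * \<epsilon> powr (- a - k - q\<^sup>2 / 2) \<le> prob (E \<epsilon>)"
      using eventually_scale by eventually_elim (use bound in force)
    have "((\<lambda>\<epsilon>. 1 - C * exp (q\<^sup>2 / 2 * variance_const) * \<epsilon> powr (- a - k - q\<^sup>2 / 2)) \<longlongrightarrow>
        1 - C * exp (q\<^sup>2 / 2 * variance_const) * 0) (at_right 0)"
      using a by (intro tendsto_intros powr_at_right_0) simp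
    then show "((\<lambda>\<epsilon>. 1 - C * exp (q\<^sup>2 / 2 * variance_const) * \<epsilon> powr (- a - k - q\<^sup>2 / 2)) \<longlongrightarrow> 1) (at_right 0)"
      by simp
  qed auto
  then show ?thesis using E unfolding whp_def E_def by simp
qed

definition crossing_event :: "real \<Rightarrow> real \<Rightarrow> real \<Rightarrow> 'w set" where
  "crossing_event \<xi> \<alpha> \<epsilon> = {\<omega> \<in> space M. crossing_dist (field \<epsilon> \<omega>) \<xi> \<epsilon> \<le> \<epsilon> powr \<alpha>}"

lemma crossing_event_measurable:
  assumes "0 < \<epsilon>" "\<epsilon> \<le> 1" shows "crossing_event \<xi> \<alpha> \<epsilon> \<in> events"
proof -
  have "(\<lambda>\<omega>. crossing_dist (field \<epsilon> \<omega>) \<xi> \<epsilon>) \<in> borel_measurable M"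
    using assms field_measurable by (intro crossing_dist_measurable)
  then show ?thesis unfolding crossing_event_def by measurable
qed

definition exponents :: "real \<Rightarrow> real set" where
  "exponents \<xi> = {\<alpha>. whp (crossing_event \<xi> \<alpha>)}"

text \<open>
  Probabilities are at most 1, so a lower limit equal to 1 is a limit.\<close>

lemma lfpp_exponent_eq: "lfpp_exponent M h \<xi> = Sup (exponents \<xi>)"
proof -
  have iff: "Liminf (at_right 0) (\<lambda>\<epsilon>. ereal (prob (E \<epsilon>))) = 1 \<longleftrightarrow> ((\<lambda>\<epsilon>. prob (E \<epsilon>)) \<longlongrightarrow> 1) (at_right 0)"
    for E :: "real \<Rightarrow> 'w set"
  proof
    assume L: "Liminf (at_right 0) (\<lambda>\<epsilon>. ereal (prob (E \<epsilon>))) = 1"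
    have "Limsup (at_right 0) (\<lambda>\<epsilon>. ereal (prob (E \<epsilon>))) \<le> 1"
      by (intro Limsup_bounded always_eventually allI) simp
    moreover have "Liminf (at_right 0) (\<lambda>\<epsilon>. ereal (prob (E \<epsilon>))) \<le> Limsup (at_right 0) (\<lambda>\<epsilon>. ereal (prob (E \<epsilon>)))"
      by (intro Liminf_le_Limsup) simp
    ultimately have "((\<lambda>\<epsilon>. ereal (prob (E \<epsilon>))) \<longlongrightarrow> ereal 1) (at_right 0)"
      using L by (subst tendsto_iff_Liminf_eq_Limsup) (auto simp: one_ereal_def)
    then show "((\<lambda>\<epsilon>. prob (E \<epsilon>)) \<longlongrightarrow> 1) (at_right 0)" by simp
  next
    assume "((\<lambda>\<epsilon>. prob (E \<epsilon>)) \<longlongrightarrow> 1) (at_right 0)"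
    then have "((\<lambda>\<epsilon>. ereal (prob (E \<epsilon>))) \<longlongrightarrow> ereal 1) (at_right 0)" by simp
    then show "Liminf (at_right 0) (\<lambda>\<epsilon>. ereal (prob (E \<epsilon>))) = 1"
      using lim_imp_Liminf[of "at_right (0::real)" "\<lambda>\<epsilon>. ereal (prob (E \<epsilon>))" "ereal 1"]
      by (simp add: one_ereal_def)
  qed
  have "exponents \<xi> = {\<alpha>. Liminf (at_right 0) (\<lambda>\<epsilon>. ereal (prob (crossing_event \<xi> \<alpha> \<epsilon>))) = 1}"
    unfolding iff exponents_def whp_def by (simp add: crossing_event_measurable)
  then show ?thesis unfolding lfpp_exponent_def crossing_event_def field_def by simp
qed

section \<open>Comparison of exponents\<close>

text \<open>
  The crossing used is the bottom row, which has about \<open>1/\<epsilon>\<close> vertices. Its length with parameter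
  \<open>r * q\<close> is at most \<open>\<epsilon>\<close> times the \<open>r\<close>-th power of \<open>\<Sum>\<^sub>z exp (q h\<^sub>\<epsilon>(z))\<close>, and the latter is typically at most about
  \<open>\<epsilon>\<^bsup>- 1 - q\<^sup>2/2\<^esup>\<close>. A factor \<open>r > 1\<close> pays off for large parameters, where the mean of the length is
  dominated by exceptionally large values of the field that typically do not occur on the row.\<close>

lemma row_exponent:
  assumes r: "1 \<le> r" and \<gamma>: "\<gamma> < 1 - r * (1 + q\<^sup>2 / 2)"
  shows "\<gamma> \<in> exponents (r * q)"
proof -
  define S where "S \<epsilon> = row_path \<epsilon> ` {0..row_length \<epsilon>}" for \<epsilon>
  have "(\<gamma> - 1) / r < - 1 - q\<^sup>2 / 2" using \<gamma> r by (simp add: field_simps)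
  then obtain a where a: "a < - 1 - q\<^sup>2 / 2" "(\<gamma> - 1) / r < a" using dense by blast
  then have \<gamma>a: "\<gamma> \<le> 1 + r * a" using r by (simp add: field_simps)
  have "whp (\<lambda>\<epsilon>. {\<omega> \<in> space M. (\<Sum>z\<in>S \<epsilon>. exp (q * field \<epsilon> \<omega> z)) \<le> \<epsilon> powr a})"
  proof (rule whp_exp_moment_sum[OF _ _ a(1)])
    fix \<epsilon> :: real assume \<epsilon>: "0 < \<epsilon>" "\<epsilon> \<le> 1"
    show "S \<epsilon> \<subseteq> lattice_square \<epsilon>"
      using row_path(1)[OF \<epsilon>(1)] by (auto simp: S_def lattice_path_def)
    have "real (card (S \<epsilon>)) \<le> real (row_length \<epsilon>) + 1"
      using card_image_le[of "{0..row_length \<epsilon>}" "row_path \<epsilon>"] by (simp add: S_def)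
    also have "\<dots> \<le> 1 / \<epsilon> + 1 / \<epsilon>"
      using row_length_bounds(1)[OF \<epsilon>(1)] \<epsilon> by (intro add_mono) (auto simp: field_simps)
    also have "\<dots> = 2 * \<epsilon> powr - 1" using \<epsilon> by (simp add: powr_minus divide_inverse)
    finally show "real (card (S \<epsilon>)) \<le> 2 * \<epsilon> powr - 1" .
  qed
  then have "whp (crossing_event (r * q) \<gamma>)"
  proof (rule whp_mono[OF _ crossing_event_measurable])
    show "\<forall>\<^sub>F \<epsilon> in at_right 0. {\<omega> \<in> space M. (\<Sum>z\<in>S \<epsilon>. exp (q * field \<epsilon> \<omega> z)) \<le> \<epsilon> powr a}
        \<subseteq> crossing_event (r * q) \<gamma> \<epsilon>"
      using eventually_scale
    proof (eventually_elim, intro subsetI)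
      fix \<epsilon> \<omega> assume \<epsilon>: "0 < \<epsilon> \<and> \<epsilon> \<le> 1"
        and \<omega>: "\<omega> \<in> {\<omega> \<in> space M. (\<Sum>z\<in>S \<epsilon>. exp (q * field \<epsilon> \<omega> z)) \<le> \<epsilon> powr a}"
      have "crossing_dist (field \<epsilon> \<omega>) (r * q) \<epsilon> \<le> lfpp_length (field \<epsilon> \<omega>) (r * q) \<epsilon> (row_length \<epsilon>) (row_path \<epsilon>)"
        using \<epsilon> row_path by (intro crossing_dist_le) auto
      also have "\<dots> = \<epsilon> * (\<Sum>z\<in>S \<epsilon>. exp (q * field \<epsilon> \<omega> z) powr r)"
        using \<epsilon> inj_row_path[of \<epsilon>] unfolding lfpp_length_def S_def
        by (subst sum.reindex) (auto simp: inj_on_def sum_distrib_left powr_def mult_ac)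
      also have "\<dots> \<le> \<epsilon> * (\<Sum>z\<in>S \<epsilon>. exp (q * field \<epsilon> \<omega> z)) powr r"
        using \<epsilon> r by (intro mult_left_mono sum_powr_le_powr_sum) (auto simp: S_def)
      also have "\<dots> \<le> \<epsilon> * (\<epsilon> powr a) powr r"
        using \<epsilon> \<omega> r by (intro mult_left_mono powr_mono2) (auto intro: sum_nonneg)
      also have "\<dots> = \<epsilon> powr (1 + r * a)" using \<epsilon> by (simp add: powr_powr powr_add mult_ac)
      also have "\<dots> \<le> \<epsilon> powr \<gamma>" using \<epsilon> \<gamma>a by (intro powr_mono') auto
      finally show "\<omega> \<in> crossing_event (r * q) \<gamma> \<epsilon>" using \<omega> by (simp add: crossing_event_def)
    qed
  qed auto
  then show ?thesis by (simp add: exponents_def)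
qed

text \<open>
  A nearly optimal crossing for \<open>\<xi>\<^sub>1\<close> is measured with \<open>\<xi>\<^sub>2\<close>, splitting the weight of each vertex by
  \<open>exp_le_threshold\<close>. The first part is controlled by the \<open>\<xi>\<^sub>1\<close>-length, the second by the sum of
  \<open>exp (- \<theta> h\<^sub>\<epsilon>)\<close> over all \<open>\<epsilon>\<^bsup>- 2\<^esup>\<close> lattice points; with the weight \<open>\<epsilon>\<close> of a vertex this accounts for
  the second bound on \<open>\<gamma>\<close>.\<close>

lemma exponents_compare:
  assumes \<alpha>: "\<alpha> \<in> exponents \<xi>\<^sub>1" and sgn: "0 \<le> (\<xi>\<^sub>2 + \<theta>) * (\<xi>\<^sub>1 - \<xi>\<^sub>2)"
    and \<gamma>: "\<gamma> < \<alpha> - (\<xi>\<^sub>1 - \<xi>\<^sub>2) * \<theta>" "\<gamma> < \<theta>\<^sup>2 / 2 + \<xi>\<^sub>2 * \<theta> - 1"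
  shows "\<gamma> \<in> exponents \<xi>\<^sub>2"
proof -
  have "\<gamma> - 1 - (\<xi>\<^sub>2 + \<theta>) * \<theta> < - 2 - (- \<theta>)\<^sup>2 / 2"
    using \<gamma>(2) by (simp add: power2_eq_square algebra_simps)
  then obtain a where "a < - 2 - (- \<theta>)\<^sup>2 / 2" "\<gamma> - 1 - (\<xi>\<^sub>2 + \<theta>) * \<theta> < a"
    using dense by blast
  then have a: "a < - 2 - (- \<theta>)\<^sup>2 / 2" "\<gamma> < 1 + (\<xi>\<^sub>2 + \<theta>) * \<theta> + a" by simp_all
  define \<delta>\<^sub>1 where "\<delta>\<^sub>1 = \<alpha> - (\<xi>\<^sub>1 - \<xi>\<^sub>2) * \<theta> - \<gamma>"
  define \<delta>\<^sub>2 where "\<delta>\<^sub>2 = 1 + (\<xi>\<^sub>2 + \<theta>) * \<theta> + a - \<gamma>"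
  define B where "B \<epsilon> = {\<omega> \<in> space M. (\<Sum>z\<in>lattice_square \<epsilon>. exp (- \<theta> * field \<epsilon> \<omega> z)) \<le> \<epsilon> powr a}" for \<epsilon>
  have "whp B" unfolding B_def
    using card_lattice_square by (intro whp_exp_moment_sum[where C = 4 and k = 2] a) auto
  then have "whp (\<lambda>\<epsilon>. crossing_event \<xi>\<^sub>1 \<alpha> \<epsilon> \<inter> B \<epsilon>)"
    using \<alpha> by (intro whp_Int) (simp add: exponents_def)
  then have "whp (crossing_event \<xi>\<^sub>2 \<gamma>)"
  proof (rule whp_mono[OF _ crossing_event_measurable])
    have "((\<lambda>\<epsilon>. 2 * \<epsilon> powr \<delta>\<^sub>1 + \<epsilon> powr \<delta>\<^sub>2) \<longlongrightarrow> 2 * 0 + 0) (at_right 0)"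
      using \<gamma> a by (intro tendsto_intros powr_at_right_0) (auto simp: \<delta>\<^sub>1_def \<delta>\<^sub>2_def)
    then have "\<forall>\<^sub>F \<epsilon> in at_right 0. 2 * \<epsilon> powr \<delta>\<^sub>1 + \<epsilon> powr \<delta>\<^sub>2 < 1"
      by (rule order_tendstoD) simp
    then show "\<forall>\<^sub>F \<epsilon> in at_right 0. crossing_event \<xi>\<^sub>1 \<alpha> \<epsilon> \<inter> B \<epsilon> \<subseteq> crossing_event \<xi>\<^sub>2 \<gamma> \<epsilon>"
      using eventually_scale
    proof (eventually_elim, intro subsetI)
      fix \<epsilon> \<omega> assume small: "2 * \<epsilon> powr \<delta>\<^sub>1 + \<epsilon> powr \<delta>\<^sub>2 < 1" and \<epsilon>: "0 < \<epsilon> \<and> \<epsilon> \<le> 1"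
        and \<omega>: "\<omega> \<in> crossing_event \<xi>\<^sub>1 \<alpha> \<epsilon> \<inter> B \<epsilon>"
      let ?f = "field \<epsilon> \<omega>"
      have "crossing_dist ?f \<xi>\<^sub>1 \<epsilon> \<le> \<epsilon> powr \<alpha>" using \<omega> by (simp add: crossing_event_def)
      also have "\<dots> < 2 * \<epsilon> powr \<alpha>" using \<epsilon> by simp
      finally obtain N P where P: "lattice_path \<epsilon> N P" "P 0 \<in> left_boundary \<epsilon>" "P N \<in> right_boundary \<epsilon>"
        "inj_on P {0..N}" "lfpp_length ?f \<xi>\<^sub>1 \<epsilon> N P < 2 * \<epsilon> powr \<alpha>"
        using crossing_dist_lessE \<epsilon> by blast
      have "(\<Sum>j = 0..N. exp (- \<theta> * ?f (P j))) = (\<Sum>z\<in>P ` {0..N}. exp (- \<theta> * ?f z))"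
        using P(4) by (simp add: sum.reindex)
      also have "\<dots> \<le> (\<Sum>z\<in>lattice_square \<epsilon>. exp (- \<theta> * ?f z))"
        using P(1) \<epsilon> finite_lattice_square by (intro sum_mono2) (auto simp: lattice_path_def)
      also have "\<dots> \<le> \<epsilon> powr a" using \<omega> by (simp add: B_def)
      finally have thick: "(\<Sum>j = 0..N. exp (- \<theta> * ?f (P j))) \<le> \<epsilon> powr a" .
      have "crossing_dist ?f \<xi>\<^sub>2 \<epsilon> \<le> lfpp_length ?f \<xi>\<^sub>2 \<epsilon> N P"
        using \<epsilon> P by (intro crossing_dist_le) auto
      also have "\<dots> \<le> (\<Sum>j = 0..N. \<epsilon> * (\<epsilon> powr (- (\<xi>\<^sub>1 - \<xi>\<^sub>2) * \<theta>) * exp (\<xi>\<^sub>1 * ?f (P j))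
          + \<epsilon> powr ((\<xi>\<^sub>2 + \<theta>) * \<theta>) * exp (- \<theta> * ?f (P j))))"
        unfolding lfpp_length_def using \<epsilon> sgn by (intro sum_mono mult_left_mono exp_le_threshold) auto
      also have "\<dots> = \<epsilon> powr (- (\<xi>\<^sub>1 - \<xi>\<^sub>2) * \<theta>) * lfpp_length ?f \<xi>\<^sub>1 \<epsilon> N P
          + \<epsilon> * \<epsilon> powr ((\<xi>\<^sub>2 + \<theta>) * \<theta>) * (\<Sum>j = 0..N. exp (- \<theta> * ?f (P j)))"
        unfolding lfpp_length_def by (simp only: sum_distrib_left sum.distrib distrib_left mult_ac)
      also have "\<dots> \<le> \<epsilon> powr (- (\<xi>\<^sub>1 - \<xi>\<^sub>2) * \<theta>) * (2 * \<epsilon> powr \<alpha>) + \<epsilon> * \<epsilon> powr ((\<xi>\<^sub>2 + \<theta>) * \<theta>) * \<epsilon> powr a"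
        using \<epsilon> P(5) thick by (intro add_mono mult_left_mono) auto
      also have "\<dots> = \<epsilon> powr \<gamma> * (2 * \<epsilon> powr \<delta>\<^sub>1 + \<epsilon> powr \<delta>\<^sub>2)"
      proof -
        have "\<epsilon> powr (- (\<xi>\<^sub>1 - \<xi>\<^sub>2) * \<theta>) * \<epsilon> powr \<alpha> = \<epsilon> powr \<gamma> * \<epsilon> powr \<delta>\<^sub>1"
          unfolding powr_add[symmetric] by (simp add: \<delta>\<^sub>1_def algebra_simps)
        moreover have "\<epsilon> powr 1 * \<epsilon> powr ((\<xi>\<^sub>2 + \<theta>) * \<theta>) * \<epsilon> powr a = \<epsilon> powr \<gamma> * \<epsilon> powr \<delta>\<^sub>2"
          unfolding powr_add[symmetric] by (simp add: \<delta>\<^sub>2_def algebra_simps)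
        ultimately show ?thesis using \<epsilon> by (simp add: distrib_left)
      qed
      also have "\<dots> \<le> \<epsilon> powr \<gamma>" using small by (intro mult_left_le) auto
      finally show "\<omega> \<in> crossing_event \<xi>\<^sub>2 \<gamma> \<epsilon>" using \<omega> by (simp add: crossing_event_def)
    qed
  qed auto
  then show ?thesis by (simp add: exponents_def)
qed

text \<open>
  With parameter 0 the length counts the vertices, so it is bounded below deterministically.\<close>

lemma exponents_0_le: assumes "\<alpha> \<in> exponents 0" shows "\<alpha> \<le> 0"
proof (rule ccontr)
  assume "\<not> \<alpha> \<le> 0"
  then have "((\<lambda>\<epsilon>. \<epsilon> powr \<alpha> + \<epsilon>) \<longlongrightarrow> 0 + 0) (at_right 0)"
    by (intro tendsto_add powr_at_right_0 tendsto_ident_at) simp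
  then have "\<forall>\<^sub>F \<epsilon> in at_right 0. \<epsilon> powr \<alpha> + \<epsilon> < 1" by (rule order_tendstoD) simp
  then have "\<forall>\<^sub>F \<epsilon> in at_right 0. prob (crossing_event 0 \<alpha> \<epsilon>) = 0"
    using eventually_scale
  proof eventually_elim
    case (elim \<epsilon>)
    then have "crossing_event 0 \<alpha> \<epsilon> = {}"
      using crossing_dist_0_ge[of \<epsilon>] unfolding crossing_event_def by (smt (verit) Collect_empty_eq)
    then show ?case by simp
  qed
  then have "((\<lambda>\<epsilon>. prob (crossing_event 0 \<alpha> \<epsilon>)) \<longlongrightarrow> 0) (at_right 0)"
    by (rule tendsto_eventually)
  moreover have "((\<lambda>\<epsilon>. prob (crossing_event 0 \<alpha> \<epsilon>)) \<longlongrightarrow> 1) (at_right 0)"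
    using assms by (simp add: exponents_def whp_def)
  ultimately show False using tendsto_unique[OF trivial_limit_at_right_real] by fastforce
qed

text \<open>
  Comparison with parameter 0 at \<open>\<theta> = 2\<close>. In particular the suprema that define the exponents are
  finite.\<close>

lemma exponents_le:
  assumes \<xi>: "0 \<le> \<xi>" and \<alpha>: "\<alpha> \<in> exponents \<xi>" shows "\<alpha> \<le> 2 * \<xi>"
proof (rule ccontr)
  assume "\<not> \<alpha> \<le> 2 * \<xi>"
  then have "min (\<alpha> - 2 * \<xi>) 1 / 2 \<in> exponents 0"
    using exponents_compare[OF \<alpha>, of 0 2 "min (\<alpha> - 2 * \<xi>) 1 / 2"] \<xi> by (auto simp: min_def)
  from exponents_0_le[OF this] show False using \<open>\<not> \<alpha> \<le> 2 * \<xi>\<close> by auto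
qed

abbreviation lam :: "real \<Rightarrow> real" where "lam \<equiv> lfpp_exponent M h"

lemma exponents_bdd_above: "0 \<le> \<xi> \<Longrightarrow> bdd_above (exponents \<xi>)"
  using exponents_le by (intro bdd_aboveI)

lemma exponents_nonempty: "exponents \<xi> \<noteq> {}"
  using row_exponent[of 1 "- \<xi>\<^sup>2 / 2 - 1" \<xi>] by auto

lemma lam_le: "0 \<le> \<xi> \<Longrightarrow> lam \<xi> \<le> 2 * \<xi>"
  unfolding lfpp_exponent_eq using exponents_nonempty exponents_le by (intro cSup_least)

lemma lam_geI:
  assumes "0 \<le> \<xi>" "\<And>\<gamma>. \<gamma> < x \<Longrightarrow> \<gamma> \<in> exponents \<xi>" shows "x \<le> lam \<xi>"
  unfolding lfpp_exponent_eq
  by (rule dense_le) (use assms exponents_bdd_above in \<open>auto intro!: cSup_upper\<close>)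

lemma lam_row_ge:
  assumes "1 \<le> r" "0 \<le> q" shows "1 - r * (1 + q\<^sup>2 / 2) \<le> lam (r * q)"
  using assms row_exponent by (intro lam_geI) auto

lemma lam_compare:
  assumes \<xi>: "0 \<le> \<xi>\<^sub>2" and sgn: "0 \<le> (\<xi>\<^sub>2 + \<theta>) * (\<xi>\<^sub>1 - \<xi>\<^sub>2)"
  shows "min (lam \<xi>\<^sub>1 - (\<xi>\<^sub>1 - \<xi>\<^sub>2) * \<theta>) (\<theta>\<^sup>2 / 2 + \<xi>\<^sub>2 * \<theta> - 1) \<le> lam \<xi>\<^sub>2"
proof (rule lam_geI[OF \<xi>])
  fix \<gamma> assume \<gamma>: "\<gamma> < min (lam \<xi>\<^sub>1 - (\<xi>\<^sub>1 - \<xi>\<^sub>2) * \<theta>) (\<theta>\<^sup>2 / 2 + \<xi>\<^sub>2 * \<theta> - 1)"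
  then have "\<gamma> + (\<xi>\<^sub>1 - \<xi>\<^sub>2) * \<theta> < Sup (exponents \<xi>\<^sub>1)" by (simp add: lfpp_exponent_eq)
  then obtain \<alpha> where "\<alpha> \<in> exponents \<xi>\<^sub>1" "\<gamma> + (\<xi>\<^sub>1 - \<xi>\<^sub>2) * \<theta> < \<alpha>"
    using less_cSupD[OF exponents_nonempty] by blast
  then show "\<gamma> \<in> exponents \<xi>\<^sub>2" using exponents_compare[OF _ sgn] \<gamma> by auto
qed

section \<open>Increments of the exponent\<close>

definition kappa :: "real \<Rightarrow> real" where "kappa \<xi> = sqrt (2 + 2 * lam \<xi> + \<xi>\<^sup>2) - \<xi>"

lemma lam_ge_square: "0 \<le> \<xi> \<Longrightarrow> - \<xi>\<^sup>2 / 2 \<le> lam \<xi>"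
  using lam_row_ge[of 1 \<xi>] by simp

text \<open>
  The choice \<open>q = sqrt 2\<close> corresponds to the maximum of the field on a row, about \<open>sqrt 2\<close> times
  \<open>log (1/\<epsilon>)\<close>.\<close>

lemma lam_ge_linear: "sqrt 2 \<le> \<xi> \<Longrightarrow> 1 - sqrt 2 * \<xi> \<le> lam \<xi>"
proof -
  assume \<xi>: "sqrt 2 \<le> \<xi>"
  have "1 \<le> \<xi> / sqrt 2" using \<xi> by simp
  from lam_row_ge[OF this, of "sqrt 2"] have "1 - \<xi> / sqrt 2 * 2 \<le> lam \<xi>" by simp
  moreover have "\<xi> / sqrt 2 * 2 = sqrt 2 * \<xi>"
  proof -
    have "\<xi> / sqrt 2 * 2 = (2 / sqrt 2) * \<xi>" by simp
    then show ?thesis by (simp only: real_div_sqrt zero_le_numeral)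
  qed
  ultimately show ?thesis by simp
qed

text \<open>
  The number \<open>\<kappa> = kappa \<xi>\<close> solves \<open>\<kappa>\<^sup>2/2 + \<xi> \<kappa> - 1 = \<lambda>(\<xi>)\<close>, which makes the two bounds in \<open>lam_compare\<close>
  coincide at \<open>\<theta> = \<kappa>\<close>. If \<open>\<xi>' + \<kappa> < 0\<close>, this comparison is not available, but then the row bounds
  give \<open>- sqrt 2 \<le> \<xi>' + \<kappa>\<close>, and therefore \<open>\<kappa>\<^sup>2/2 + \<xi>' \<kappa> - 1 = (\<xi>' + \<kappa>)\<^sup>2/2 - 1 - \<xi>'\<^sup>2/2\<close> is at most the
  row bound \<open>- \<xi>'\<^sup>2/2\<close> for \<open>\<lambda>(\<xi>')\<close>.\<close>

lemma lam_increment_le: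
  assumes "0 \<le> \<xi>'" "\<xi>' < \<xi>"
  shows "lam \<xi> - lam \<xi>' \<le> kappa \<xi> * (\<xi> - \<xi>')"
proof -
  let ?\<kappa> = "kappa \<xi>"
  have \<xi>: "0 \<le> \<xi>" using assms by simp
  have nonneg: "0 \<le> 2 + 2 * lam \<xi> + \<xi>\<^sup>2" using lam_ge_square[OF \<xi>] by simp
  then have "(?\<kappa> + \<xi>)\<^sup>2 = 2 + 2 * lam \<xi> + \<xi>\<^sup>2" by (simp add: kappa_def)
  then have root: "?\<kappa>\<^sup>2 / 2 + \<xi> * ?\<kappa> - 1 = lam \<xi>" by (simp add: power2_eq_square algebra_simps)
  have same: "?\<kappa>\<^sup>2 / 2 + \<xi>' * ?\<kappa> - 1 = lam \<xi> - (\<xi> - \<xi>') * ?\<kappa>"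
    using root by (simp add: algebra_simps)
  have "lam \<xi> - (\<xi> - \<xi>') * ?\<kappa> \<le> lam \<xi>'"
  proof (cases "0 \<le> \<xi>' + ?\<kappa>")
    case True
    then show ?thesis using lam_compare[of \<xi>' ?\<kappa> \<xi>] assms same by simp
  next
    case False
    have "- sqrt 2 \<le> \<xi>' + ?\<kappa>"
    proof (cases "sqrt 2 \<le> \<xi>")
      case True
      have "(\<xi> - sqrt 2)\<^sup>2 = \<xi>\<^sup>2 + 2 - 2 * (sqrt 2 * \<xi>)" by (simp add: power2_eq_square algebra_simps)
      then have "(\<xi> - sqrt 2)\<^sup>2 \<le> 2 + 2 * lam \<xi> + \<xi>\<^sup>2" using lam_ge_linear[OF True] by linarith
      then have "\<xi> - sqrt 2 \<le> sqrt (2 + 2 * lam \<xi> + \<xi>\<^sup>2)" using True by (intro real_le_rsqrt)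
      then show ?thesis using assms by (simp add: kappa_def)
    next
      case False
      then show ?thesis using assms nonneg real_sqrt_ge_zero[OF nonneg] unfolding kappa_def by linarith
    qed
    then have "(\<xi>' + ?\<kappa>)\<^sup>2 \<le> (sqrt 2)\<^sup>2"
      using False by (intro power2_le_iff_abs_le[THEN iffD2]) auto
    then have "?\<kappa>\<^sup>2 / 2 + \<xi>' * ?\<kappa> - 1 \<le> - \<xi>'\<^sup>2 / 2" by (simp add: power2_eq_square algebra_simps)
    then show ?thesis using lam_ge_square[OF assms(1)] same by simp
  qed
  then show ?thesis by (simp add: algebra_simps)
qed

lemma kappa_le: assumes "0 \<le> \<xi>" shows "kappa \<xi> \<le> 2"
proof -
  have "2 + 2 * lam \<xi> + \<xi>\<^sup>2 \<le> (\<xi> + 2)\<^sup>2"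
    using lam_le[OF assms] by (simp add: power2_eq_square algebra_simps)
  then have "sqrt (2 + 2 * lam \<xi> + \<xi>\<^sup>2) \<le> \<xi> + 2" using assms by (intro real_le_lsqrt) auto
  then show ?thesis by (simp add: kappa_def)
qed

text \<open>
  Increments are bounded above because \<open>kappa\<close> is at most 2. Below, the comparison is used in the
  direction of an increasing parameter at \<open>\<theta> = - A\<close>, discarding the vertices where the field exceeds
  \<open>A log (1/\<epsilon>)\<close>; for \<open>A = 2 * K + 4\<close> their contribution is negligible uniformly on \<open>{0..K}\<close>.\<close>

lemma lam_lipschitz:
  assumes x: "x \<in> {0..K}" and y: "y \<in> {0..K}"
  shows "\<bar>lam x - lam y\<bar> \<le> (2 * K + 4) * \<bar>x - y\<bar>"
proof -
  define A where "A = 2 * K + 4"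
  have *: "\<bar>lam \<xi> - lam \<xi>'\<bar> \<le> A * (\<xi> - \<xi>')" if \<xi>: "0 \<le> \<xi>'" "\<xi>' < \<xi>" "\<xi> \<le> K" for \<xi> \<xi>'
  proof -
    have "lam \<xi> - lam \<xi>' \<le> kappa \<xi> * (\<xi> - \<xi>')" using lam_increment_le \<xi> by simp
    also have "\<dots> \<le> A * (\<xi> - \<xi>')"
      using kappa_le[of \<xi>] \<xi> by (intro mult_right_mono) (auto simp: A_def)
    finally have up: "lam \<xi> - lam \<xi>' \<le> A * (\<xi> - \<xi>')" .
    have "lam \<xi>' + A * \<xi>' \<le> A\<^sup>2 / 2 - 1"
    proof -
      have "lam \<xi>' + A * \<xi>' \<le> (2 + A) * \<xi>'" using lam_le[OF \<xi>(1)] by (simp add: algebra_simps)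
      also have "\<dots> \<le> (2 + A) * K" using \<xi> by (intro mult_left_mono) (auto simp: A_def)
      also have "\<dots> \<le> A\<^sup>2 / 2 - 1" using \<xi> by (simp add: A_def power2_eq_square algebra_simps)
      finally show ?thesis .
    qed
    then have "lam \<xi>' - A * (\<xi> - \<xi>') \<le> A\<^sup>2 / 2 - \<xi> * A - 1" by (simp add: algebra_simps)
    moreover have "min (lam \<xi>' - (\<xi>' - \<xi>) * (- A)) ((- A)\<^sup>2 / 2 + \<xi> * (- A) - 1) \<le> lam \<xi>"
      using \<xi> by (intro lam_compare) (auto simp: A_def intro: mult_nonpos_nonpos)
    ultimately have "lam \<xi>' - A * (\<xi> - \<xi>') \<le> lam \<xi>" by (simp add: algebra_simps min_def split: if_splits)
    with up show ?thesis by (simp add: abs_le_iff)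
  qed
  show ?thesis
    using *[of x y] *[of y x] x y unfolding A_def[symmetric]
    by (cases x y rule: linorder_cases) (auto simp: abs_minus_commute)
qed

end

theorem corollary2p2:
  fixes M :: "'w measure" and h :: "complex measure \<Rightarrow> 'w \<Rightarrow> real" and lam :: "real \<Rightarrow> real"
  assumes "prob_space M"
    and "normalized_whole_plane_GFF M h"
  defines "lam \<equiv> lfpp_exponent M h"
  shows "(\<forall>\<xi>' \<xi>. 0 \<le> \<xi>' \<and> \<xi>' < \<xi> \<longrightarrow>
            (lam \<xi> - lam \<xi>') / (\<xi> - \<xi>') \<le> sqrt (2 + 2 * lam \<xi> + \<xi>\<^sup>2) - \<xi>) \<and>
         (AE \<xi> in lebesgue. 0 \<le> \<xi> \<longrightarrow>
            (\<exists>d. (lam has_real_derivative d) (at \<xi> within {0..}) \<and>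
                 d \<le> sqrt (2 + 2 * lam \<xi> + \<xi>\<^sup>2) - \<xi>))"
proof -
  interpret normalized_GFF M h
    using assms(1,2) by (simp add: normalized_GFF_def normalized_GFF_axioms_def)
  have quotient: "(lam \<xi> - lam \<xi>') / (\<xi> - \<xi>') \<le> kappa \<xi>" if "0 \<le> \<xi>'" "\<xi>' < \<xi>" for \<xi> \<xi>'
    using lam_increment_le[OF that] that by (simp add: lam_def pos_divide_le_eq)
  have deriv_le: "d \<le> kappa \<xi>" if d: "(lam has_real_derivative d) (at \<xi>)" and \<xi>: "0 < \<xi>" for d \<xi>
  proof -
    have "((\<lambda>y. (lam y - lam \<xi>) / (y - \<xi>)) \<longlongrightarrow> d) (at_left \<xi>)"
      using d by (simp add: has_field_derivative_iff filterlim_at_split)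
    moreover have "\<forall>\<^sub>F y in at_left \<xi>. (lam y - lam \<xi>) / (y - \<xi>) \<le> kappa \<xi>"
    proof -
      have "(lam y - lam \<xi>) / (y - \<xi>) \<le> kappa \<xi>" if "0 < y" "y < \<xi>" for y
        using quotient[of y \<xi>] that minus_divide_divide[of "lam y - lam \<xi>" "y - \<xi>"] by simp
      then show ?thesis using \<xi> unfolding eventually_at_left_field by blast
    qed
    ultimately show ?thesis by (rule tendsto_upperbound) simp
  qed
  \<comment> \<open>Clamping the argument to a bounded interval turns the local Lipschitz bound into a global one.\<close>
  have local: "AE \<xi> in lborel. 0 < \<xi> \<and> \<xi> < real K \<longrightarrow> lam differentiable (at \<xi>)" for K :: nat
  proof -
    define f where "f x = lam (max 0 (min x (real K)))" for x
    have "AE \<xi> in lborel. f differentiable (at \<xi>)"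
    proof (rule AE_differentiable_of_lipschitz)
      fix x y :: real
      have "\<bar>f x - f y\<bar> \<le> (2 * real K + 4) * \<bar>max 0 (min x (real K)) - max 0 (min y (real K))\<bar>"
        unfolding f_def lam_def by (intro lam_lipschitz) auto
      also have "\<dots> \<le> (2 * real K + 4) * \<bar>x - y\<bar>"
      proof (rule mult_left_mono)
        show "\<bar>max 0 (min x (real K)) - max 0 (min y (real K))\<bar> \<le> \<bar>x - y\<bar>" by linarith
      qed simp
      finally show "\<bar>f x - f y\<bar> \<le> (2 * real K + 4) * \<bar>x - y\<bar>" .
    qed
    then show ?thesis
    proof (eventually_elim, intro impI)
      fix \<xi> assume diff: "f differentiable (at \<xi>)" and \<xi>: "0 < \<xi> \<and> \<xi> < real K"
      have "\<forall>\<^sub>F x in nhds \<xi>. x \<in> {0<..<real K}" using \<xi> by (intro eventually_nhds_in_open) auto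
      then have "\<forall>\<^sub>F x in nhds \<xi>. f x = lam x" by eventually_elim (simp add: f_def)
      moreover obtain d where "(f has_real_derivative d) (at \<xi>)"
        using diff real_differentiable_def by blast
      ultimately have "(lam has_real_derivative d) (at \<xi>)"
        using DERIV_cong_ev[OF refl _ refl] by blast
      then show "lam differentiable (at \<xi>)" using real_differentiable_def by blast
    qed
  qed
  have "AE \<xi> in lborel. \<forall>K::nat. 0 < \<xi> \<and> \<xi> < real K \<longrightarrow> lam differentiable (at \<xi>)"
    unfolding AE_all_countable using local by blast
  moreover have "AE \<xi> in lborel. \<xi> \<noteq> (0::real)"
    by (rule AE_lborel_singleton)
  ultimately have "AE \<xi> in lborel. 0 \<le> \<xi> \<longrightarrow>
      (\<exists>d. (lam has_real_derivative d) (at \<xi> within {0..}) \<and> d \<le> kappa \<xi>)"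
  proof (eventually_elim, intro impI)
    fix \<xi> :: real
    assume diff: "\<forall>K::nat. 0 < \<xi> \<and> \<xi> < real K \<longrightarrow> lam differentiable (at \<xi>)" and "\<xi> \<noteq> 0" "0 \<le> \<xi>"
    obtain K where "\<xi> < real K" using reals_Archimedean2 by blast
    with diff \<open>\<xi> \<noteq> 0\<close> \<open>0 \<le> \<xi>\<close> obtain d where d: "(lam has_real_derivative d) (at \<xi>)"
      using real_differentiable_def by fastforce
    have "(lam has_real_derivative d) (at \<xi> within {0..})"
      by (rule has_field_derivative_at_within[OF d])
    then show "\<exists>d. (lam has_real_derivative d) (at \<xi> within {0..}) \<and> d \<le> kappa \<xi>"
      using deriv_le[OF d] \<open>\<xi> \<noteq> 0\<close> \<open>0 \<le> \<xi>\<close> by auto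
  qed
  then have "AE \<xi> in lebesgue. 0 \<le> \<xi> \<longrightarrow>
      (\<exists>d. (lam has_real_derivative d) (at \<xi> within {0..}) \<and> d \<le> kappa \<xi>)"
    by (rule AE_completion)
  with quotient show ?thesis unfolding kappa_def lam_def by blast
qed

end
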